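(* Let $k$ be an algebraically closed field of characteristic zero, $G$ a connected linear algebraic group over $k$, $V$ a rational representation of $G$, $v \in V$, and $R$ a torus of $G$. There exists a nonempty open subscheme $U \subset G$ such that $\mathcal P_{g.v}(R) = \mathcal P_{g'.v}(R)$ for all $g, g' \in U$.
   Context: $X(R)$ denotes the character group of $R$. For $u \in V$ with $R$-weight decomposition $u = \sum_{\chi\in X(R)} u_\chi$, the (GIT) state of $u$ is $\Xi_u(R) = \{\chi \in X(R) \mid u_\chi \neq 0\}$, and the state polytope $\mathcal P_u(R)$ is the convex hull of $\Xi_u(R)$ in $X(R)_{\mathbb R} = X(R)\otimes_{\mathbb Z}\mathbb R$. *)

theory Defs
  imports
    "HOL-Analysis.Analysis"
    "HOL-Analysis.Finite_Function_Topology"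
    "HOL-Computational_Algebra.Polynomial"
    "HOL-Algebra.Group"
begin

inductive_set subalgebra_generated :: "('a \<Rightarrow> 'k::comm_ring_1) set \<Rightarrow> ('a \<Rightarrow> 'k) set"
  for F :: "('a \<Rightarrow> 'k) set" where
  generator: "f \<in> F \<Longrightarrow> f \<in> subalgebra_generated F"
| const: "(\<lambda>_. c) \<in> subalgebra_generated F"
| add: "f \<in> subalgebra_generated F \<Longrightarrow> g \<in> subalgebra_generated F
    \<Longrightarrow> (\<lambda>x. f x + g x) \<in> subalgebra_generated F"
| mult: "f \<in> subalgebra_generated F \<Longrightarrow> g \<in> subalgebra_generated F
    \<Longrightarrow> (\<lambda>x. f x * g x) \<in> subalgebra_generated F"

text \<open>
  Over an algebraically closed field we work with sets of rational points. If \<open>S\<close> is the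
  coordinate ring of an ambient affine variety, the coordinate ring of a closed subvariety \<open>X\<close>
  consists of the restrictions of the elements of \<open>S\<close> to \<open>X\<close>; functions are compared on \<open>X\<close> only.
\<close>

definition restrictions :: "('a \<Rightarrow> 'k) set \<Rightarrow> 'a set \<Rightarrow> ('a \<Rightarrow> 'k) set" where
  "restrictions S X = {f. \<exists>F\<in>S. \<forall>x\<in>X. f x = F x}"


section \<open>Linear algebraic groups\<close>

definition GL :: "('k::field ^'n^'n) monoid" where
  "GL = \<lparr>carrier = {A. invertible A}, mult = (**), one = mat 1\<rparr>"

definition GL_coordinate_ring :: "('k::field ^'n^'n \<Rightarrow> 'k) set" where
  "GL_coordinate_ring =
     subalgebra_generated (insert (\<lambda>A. inverse (det A)) {\<lambda>A. A $ i $ j | i j. True})"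

definition zariski_GL :: "('k::field ^'n^'n) topology" where
  "zariski_GL = topology (\<lambda>U. \<exists>F \<subseteq> GL_coordinate_ring.
     U = {A \<in> carrier GL. \<exists>f\<in>F. f A \<noteq> 0})"

lemma istopology_nonvanishing_loci:
  fixes S :: "('a \<Rightarrow> 'k::idom) set"
  assumes mult: "\<And>f g. f \<in> S \<Longrightarrow> g \<in> S \<Longrightarrow> (\<lambda>x. f x * g x) \<in> S"
  shows "istopology (\<lambda>U. \<exists>F \<subseteq> S. U = {x \<in> X. \<exists>f\<in>F. f x \<noteq> 0})"
proof -
  let ?D = "\<lambda>F. {x \<in> X. \<exists>f\<in>F. f x \<noteq> 0}"
  have inter: "\<exists>H \<subseteq> S. ?D F \<inter> ?D G = ?D H" if FG: "F \<subseteq> S" "G \<subseteq> S" for F G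
  proof (intro exI conjI)
    let ?H = "{h \<in> S. \<forall>x\<in>X. h x \<noteq> 0 \<longrightarrow> x \<in> ?D F \<inter> ?D G}"
    show "?H \<subseteq> S" by simp
    show "?D F \<inter> ?D G = ?D ?H"
    proof
      show "?D F \<inter> ?D G \<subseteq> ?D ?H"
      proof
        fix x assume "x \<in> ?D F \<inter> ?D G"
        then obtain f g where fg: "x \<in> X" "f \<in> F" "f x \<noteq> 0" "g \<in> G" "g x \<noteq> 0" by auto
        have "(\<lambda>x. f x * g x) \<in> ?H" using FG fg mult by auto
        then have "\<exists>h\<in>?H. h x \<noteq> 0"
          using fg by (intro bexI[where x = "\<lambda>x. f x * g x"]) simp_all
        then show "x \<in> ?D ?H" using fg(1) by simp
      qed
    qed auto
  qed
  have union: "\<exists>H \<subseteq> S. \<Union>\<K> = ?D H" if \<K>: "\<And>K. K \<in> \<K> \<Longrightarrow> \<exists>F \<subseteq> S. K = ?D F" for \<K>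
  proof (intro exI conjI)
    let ?H = "{f \<in> S. \<forall>x\<in>X. f x \<noteq> 0 \<longrightarrow> x \<in> \<Union>\<K>}"
    show "?H \<subseteq> S" by blast
    show "\<Union>\<K> = ?D ?H"
    proof
      show "\<Union>\<K> \<subseteq> ?D ?H"
      proof
        fix x assume "x \<in> \<Union>\<K>"
        then obtain K where K: "K \<in> \<K>" "x \<in> K" by blast
        obtain F where F: "F \<subseteq> S" "K = ?D F" using \<K>[OF K(1)] by blast
        then obtain f where f: "f \<in> F" "x \<in> X" "f x \<noteq> 0" using K(2) by (auto simp: F(2))
        have "\<forall>x\<in>X. f x \<noteq> 0 \<longrightarrow> x \<in> K" using f(1) by (auto simp: F(2))
        then have "f \<in> ?H" using F(1) f(1) K(1) by auto
        then show "x \<in> ?D ?H" using f by auto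
      qed
    qed auto
  qed
  show ?thesis
    unfolding istopology_def
  proof (rule conjI; intro allI impI)
    fix U W assume "\<exists>F \<subseteq> S. U = ?D F" "\<exists>F \<subseteq> S. W = ?D F"
    then obtain F G where "F \<subseteq> S" "U = ?D F" "G \<subseteq> S" "W = ?D G" by (elim exE conjE)
    then show "\<exists>H \<subseteq> S. U \<inter> W = ?D H" using inter[of F G] by (simp only:)
  next
    fix \<K> assume "\<forall>K\<in>\<K>. \<exists>F \<subseteq> S. K = ?D F"
    then show "\<exists>H \<subseteq> S. \<Union>\<K> = ?D H" by (intro union) (rule bspec)
  qed
qed

lemma openin_zariski_GL:
  "openin (zariski_GL :: ('k::field ^'n^'n) topology) U \<longleftrightarrow>
     (\<exists>F \<subseteq> GL_coordinate_ring. U = {A \<in> carrier GL. \<exists>f\<in>F. f A \<noteq> 0})"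
  unfolding zariski_GL_def
  by (subst topology_inverse'[OF istopology_nonvanishing_loci])
    (simp_all add: GL_coordinate_ring_def subalgebra_generated.mult)

definition linear_algebraic_group :: "('k::field ^'n^'n) set \<Rightarrow> bool" where
  "linear_algebraic_group G \<longleftrightarrow> subgroup G GL \<and> closedin zariski_GL G"

abbreviation regular_functions :: "('k::field ^'n^'n) set \<Rightarrow> ('k^'n^'n \<Rightarrow> 'k) set" where
  "regular_functions G \<equiv> restrictions GL_coordinate_ring G"

abbreviation zariski :: "('k::field ^'n^'n) set \<Rightarrow> ('k^'n^'n) topology" where
  "zariski G \<equiv> subtopology zariski_GL G"


section \<open>Tori and characters\<close>

text \<open>
  The split torus of rank \<open>r\<close>: its points are the \<open>r\<close>-tuples of units, extended by \<open>1\<close> to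
  sequences.
\<close>

definition split_torus :: "nat \<Rightarrow> (nat \<Rightarrow> 'k::field) monoid" where
  "split_torus r = \<lparr>carrier = {t. (\<forall>i<r. t i \<noteq> 0) \<and> (\<forall>i\<ge>r. t i = 1)},
     mult = (\<lambda>s t i. s i * t i), one = (\<lambda>_. 1)\<rparr>"

definition split_torus_coordinate_ring :: "nat \<Rightarrow> ((nat \<Rightarrow> 'k::field) \<Rightarrow> 'k) set" where
  "split_torus_coordinate_ring r =
     subalgebra_generated ({\<lambda>t. t i | i. i < r} \<union> {\<lambda>t. inverse (t i) | i. i < r})"

text \<open>
  A torus is an algebraic group isomorphic to some split torus: \<open>\<phi>\<close> and \<open>\<psi>\<close> are mutually inverse
  group homomorphisms, and both pull regular functions back to regular functions.
\<close>

definition torus :: "('k::field ^'n^'n) set \<Rightarrow> bool" where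
  "torus R \<longleftrightarrow> linear_algebraic_group R \<and>
     (\<exists>r \<phi> \<psi>. group_isomorphisms (GL\<lparr>carrier := R\<rparr>) (split_torus r) \<phi> \<psi> \<and>
        (\<forall>f\<in>split_torus_coordinate_ring r. f \<circ> \<phi> \<in> regular_functions R) \<and>
        (\<forall>f\<in>GL_coordinate_ring.
           f \<circ> \<psi> \<in> restrictions (split_torus_coordinate_ring r) (carrier (split_torus r))))"

text \<open>
  Characters are made extensional, so that they are equal as HOL functions if and only if they
  agree on \<open>R\<close>. The inverse of a character is regular too, since inversion on \<open>R\<close> is; hence
  these are exactly the morphisms of algebraic groups from \<open>R\<close> to the multiplicative group.
\<close>

definition character_group :: "('k::field ^'n^'n) set \<Rightarrow> ('k^'n^'n \<Rightarrow> 'k) monoid" where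
  "character_group R =
     \<lparr>carrier = {\<theta> \<in> extensional R. \<theta> \<in> regular_functions R \<and> (\<forall>t\<in>R. \<theta> t \<noteq> 0) \<and>
                   (\<forall>s\<in>R. \<forall>t\<in>R. \<theta> (s ** t) = \<theta> s * \<theta> t)},
      mult = (\<lambda>\<theta> \<psi>. restrict (\<lambda>t. \<theta> t * \<psi> t) R),
      one = restrict (\<lambda>_. 1) R\<rparr>"


section \<open>Rational representations, states and state polytopes\<close>

text \<open>
  \<open>V\<close> is the type \<open>'v\<close> with scalar multiplication \<open>scl\<close>. As usual for rational modules, \<open>V\<close> may
  have infinite dimension, provided that each vector lies in a finite-dimensional \<open>G\<close>-stable
  subspace (with basis \<open>B\<close>) on which \<open>G\<close> acts with regular matrix coefficients. If \<open>V\<close> is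
  finite-dimensional, this says that \<open>G \<rightarrow> GL(V)\<close> is a morphism of algebraic groups.
\<close>

definition rational_representation ::
  "('k \<Rightarrow> 'v \<Rightarrow> 'v) \<Rightarrow> ('k::field ^'n^'n) set \<Rightarrow> ('k^'n^'n \<Rightarrow> 'v \<Rightarrow> 'v::ab_group_add) \<Rightarrow> bool" where
  "rational_representation scl G \<rho> \<longleftrightarrow>
     vector_space scl \<and>
     (\<forall>g\<in>G. Vector_Spaces.linear scl scl (\<rho> g)) \<and>
     (\<forall>v. \<rho> (mat 1) v = v) \<and>
     (\<forall>g\<in>G. \<forall>h\<in>G. \<forall>v. \<rho> (g ** h) v = \<rho> g (\<rho> h v)) \<and>
     (\<forall>v. \<exists>B. finite B \<and> \<not> module.dependent scl B \<and> v \<in> module.span scl B \<and>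
        (\<forall>b\<in>B. (\<forall>g\<in>G. \<rho> g b \<in> module.span scl B) \<and>
           (\<forall>b'\<in>B. (\<lambda>g. module.representation scl B (\<rho> g b) b') \<in> regular_functions G)))"

definition weight_space ::
  "('k \<Rightarrow> 'v \<Rightarrow> 'v) \<Rightarrow> ('k::field ^'n^'n \<Rightarrow> 'v \<Rightarrow> 'v) \<Rightarrow> ('k^'n^'n) set \<Rightarrow> ('k^'n^'n \<Rightarrow> 'k)
     \<Rightarrow> 'v set" where
  "weight_space scl \<rho> R \<theta> = {w. \<forall>t\<in>R. \<rho> t w = scl (\<theta> t) w}"

definition weight_decomposition ::
  "('k \<Rightarrow> 'v \<Rightarrow> 'v) \<Rightarrow> ('k::field ^'n^'n \<Rightarrow> 'v \<Rightarrow> 'v) \<Rightarrow> ('k^'n^'n) set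
     \<Rightarrow> 'v::ab_group_add \<Rightarrow> ('k^'n^'n \<Rightarrow> 'k) \<Rightarrow> 'v" where
  "weight_decomposition scl \<rho> R u =
     (THE c. finite {\<theta>. c \<theta> \<noteq> 0} \<and>
        (\<forall>\<theta> \<in> carrier (character_group R). c \<theta> \<in> weight_space scl \<rho> R \<theta>) \<and>
        (\<forall>\<theta>. \<theta> \<notin> carrier (character_group R) \<longrightarrow> c \<theta> = 0) \<and>
        u = (\<Sum>\<theta> | c \<theta> \<noteq> 0. c \<theta>))"

definition state ::
  "('k \<Rightarrow> 'v \<Rightarrow> 'v) \<Rightarrow> ('k::field ^'n^'n \<Rightarrow> 'v \<Rightarrow> 'v) \<Rightarrow> ('k^'n^'n) set
     \<Rightarrow> 'v::ab_group_add \<Rightarrow> ('k^'n^'n \<Rightarrow> 'k) set" where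
  "state scl \<rho> R u =
     {\<theta> \<in> carrier (character_group R). weight_decomposition scl \<rho> R u \<theta> \<noteq> 0}"

text \<open>
  For an abelian group \<open>A\<close>, the real vector space obtained from \<open>A\<close> by extension of scalars from
  the integers is the free real vector space on \<open>A\<close> modulo the subspace \<open>realification_relations A\<close>.
  Its elements are represented as cosets: \<open>realification_class A x\<close> is the coset of \<open>x\<close>, and the
  image of \<open>a \<in> A\<close> (that is, \<open>a \<otimes> 1\<close>) is the coset of \<open>Poly_Mapping.single a 1\<close>.
\<close>

definition realification_relations :: "('a, 'b) monoid_scheme \<Rightarrow> ('a \<Rightarrow>\<^sub>0 real) set" where
  "realification_relations A =
     span {Poly_Mapping.single (a \<otimes>\<^bsub>A\<^esub> b) 1 - Poly_Mapping.single a 1 - Poly_Mapping.single b 1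
           | a b. a \<in> carrier A \<and> b \<in> carrier A}"

definition realification_class ::
  "('a, 'b) monoid_scheme \<Rightarrow> ('a \<Rightarrow>\<^sub>0 real) \<Rightarrow> ('a \<Rightarrow>\<^sub>0 real) set" where
  "realification_class A x = {y. y - x \<in> realification_relations A}"

text \<open>
  The quotient map is linear, so the convex hull of the images of the characters in the state is
  the image of their convex hull in the free vector space.
\<close>

definition state_polytope ::
  "('k \<Rightarrow> 'v \<Rightarrow> 'v) \<Rightarrow> ('k::field ^'n^'n \<Rightarrow> 'v \<Rightarrow> 'v) \<Rightarrow> ('k^'n^'n) set
     \<Rightarrow> 'v::ab_group_add \<Rightarrow> (('k^'n^'n \<Rightarrow> 'k) \<Rightarrow>\<^sub>0 real) set set" where
  "state_polytope scl \<rho> R u =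
     realification_class (character_group R) `
       (convex hull ((\<lambda>\<theta>. Poly_Mapping.single \<theta> 1) ` state scl \<rho> R u))"

end

theory Submission
  imports Defs "HOL-Library.Function_Algebras"
begin

text \<open>
  Let \<open>v\<^sub>\<theta>\<close> denote the component of weight \<open>\<theta>\<close> of a vector \<open>v\<close>. The orbit of \<open>v\<close> lies in a
  finite-dimensional space, where \<open>\<rho> g v = (\<Sum>b\<in>B. F b g \<cdot> b)\<close> with finite \<open>B\<close> and regular \<open>F b\<close>.
  Taking components is linear, so \<open>(\<rho> g v)\<^sub>\<theta> = (\<Sum>b\<in>B. F b g \<cdot> b\<^sub>\<theta>)\<close>. Only the finitely many \<open>\<theta>\<close>
  that occur in some \<open>b\<close> can belong to the state of \<open>\<rho> g v\<close>, and for each of them the set \<open>D \<theta>\<close> of those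
  \<open>g\<close> for which \<open>\<theta>\<close> does belong to it is open in \<open>G\<close>. On the intersection of the nonempty sets
  \<open>D \<theta>\<close> the state is constant, hence so is the state polytope. Two facts make this work.

  The intersection is nonempty because a connected linear algebraic group is irreducible
  (\<open>connected_linear_algebraic_group_irreducible\<close>). The coordinate ring is noetherian by Hilbert's basis
  theorem, so \<open>G\<close> has no infinite family of disjoint nonempty open sets, and therefore has some nonempty
  irreducible open set. Translates of it cover \<open>G\<close>, and the union of all irreducible open sets that
  meet it is irreducible and both open and closed, hence all of \<open>G\<close>
  (\<open>connected_homogeneous_irreducible\<close>).

  Weight decompositions exist and are unique (\<open>weight_decomposition_exists\<close>,
  \<open>weight_decomposition_unique\<close>). Every regular function on a torus is a combination of characters,
  so \<open>\<rho> t u = (\<Sum>\<theta>. \<theta> t \<cdot> u\<^sub>\<theta>)\<close> for suitable vectors \<open>u\<^sub>\<theta>\<close>; linear independence of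
  characters, with vector coefficients (\<open>characters_independent\<close>), shows that these are weight vectors and
  that no other choice is possible.
\<close>


section \<open>Hilbert's basis theorem\<close>

text \<open>
  The rings in question are subrings of the ring of all functions on a set, so ideals are taken with
  respect to a subring \<open>A\<close> of a type that is a commutative ring.
\<close>

inductive_set ideal_generated :: "'r::comm_ring_1 set \<Rightarrow> 'r set \<Rightarrow> 'r set"
  for A S :: "'r set" where
  zero: "0 \<in> ideal_generated A S"
| step: "p \<in> ideal_generated A S \<Longrightarrow> a \<in> A \<Longrightarrow> s \<in> S \<Longrightarrow> p + a * s \<in> ideal_generated A S"

definition unital_subring :: "'r::comm_ring_1 set \<Rightarrow> bool" where
  "unital_subring A \<longleftrightarrow> 1 \<in> A \<and> (\<forall>a\<in>A. \<forall>b\<in>A. a - b \<in> A \<and> a * b \<in> A)"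

text \<open>
  Choosing the finitely many generators inside \<open>S\<close>, and not merely inside the ideal of \<open>S\<close>, is
  what allows the property to be applied directly to sequences.
\<close>

definition noetherian_subring :: "'r::comm_ring_1 set \<Rightarrow> bool" where
  "noetherian_subring A \<longleftrightarrow> unital_subring A \<and>
     (\<forall>S \<subseteq> A. \<exists>F \<subseteq> S. finite F \<and> S \<subseteq> ideal_generated A F)"

lemma unital_subring_closed:
  assumes "unital_subring A"
  shows "0 \<in> A" "1 \<in> A"
    and "a \<in> A \<Longrightarrow> b \<in> A \<Longrightarrow> a - b \<in> A"
    and "a \<in> A \<Longrightarrow> b \<in> A \<Longrightarrow> a * b \<in> A"
    and "a \<in> A \<Longrightarrow> - a \<in> A"
    and "a \<in> A \<Longrightarrow> b \<in> A \<Longrightarrow> a + b \<in> A"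
proof -
  have *: "1 \<in> A" "\<And>a b. a \<in> A \<Longrightarrow> b \<in> A \<Longrightarrow> a - b \<in> A"
    using assms by (auto simp: unital_subring_def)
  show 0: "0 \<in> A" using *(2)[OF *(1) *(1)] by simp
  have neg: "- a \<in> A" if "a \<in> A" for a using *(2)[OF 0 that] by simp
  show "1 \<in> A" by fact
  show "a \<in> A \<Longrightarrow> b \<in> A \<Longrightarrow> a - b \<in> A" by (rule *)
  show "a \<in> A \<Longrightarrow> b \<in> A \<Longrightarrow> a * b \<in> A" using assms by (auto simp: unital_subring_def)
  show "a \<in> A \<Longrightarrow> - a \<in> A" by (rule neg)
  show "a \<in> A \<Longrightarrow> b \<in> A \<Longrightarrow> a + b \<in> A" using *(2)[of a "- b"] neg by simp
qed

lemma unital_subring_sum: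
  assumes "unital_subring A" "\<And>i. i \<in> I \<Longrightarrow> f i \<in> A"
  shows "sum f I \<in> A"
  using assms(2)
  by (induction I rule: infinite_finite_induct) (auto intro: unital_subring_closed[OF assms(1)])

lemma ideal_generated_mono:
  assumes "p \<in> ideal_generated A S" "S \<subseteq> T"
  shows "p \<in> ideal_generated A T"
  using assms(1) by induction (use assms(2) in \<open>auto intro: ideal_generated.intros\<close>)

lemma ideal_generated_generator:
  assumes "unital_subring A" "s \<in> S"
  shows "s \<in> ideal_generated A S"
  using ideal_generated.step[OF ideal_generated.zero unital_subring_closed(2)[OF assms(1)] assms(2)]
  by simp

lemma ideal_generated_add:
  assumes "p \<in> ideal_generated A S" "q \<in> ideal_generated A S"
  shows "p + q \<in> ideal_generated A S"
  using assms(2)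
  by induction (use assms(1) in \<open>auto simp: add.assoc[symmetric] intro: ideal_generated.intros\<close>)

lemma ideal_generated_mult:
  assumes A: "unital_subring A" and "p \<in> ideal_generated A S" and a: "a \<in> A"
  shows "a * p \<in> ideal_generated A S"
  using assms(2)
proof induction
  case (step p b s)
  have "a * p + (a * b) * s \<in> ideal_generated A S"
    using step a by (intro ideal_generated.step) (auto intro: unital_subring_closed[OF A])
  then show ?case by (simp add: algebra_simps)
qed (simp add: ideal_generated.zero)

lemma ideal_generated_diff:
  assumes A: "unital_subring A" and "p \<in> ideal_generated A S" "q \<in> ideal_generated A S"
  shows "p - q \<in> ideal_generated A S"
proof -
  have "(- 1) * q \<in> ideal_generated A S"
    using A assms(3) by (intro ideal_generated_mult) (auto intro: unital_subring_closed[OF A])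
  from ideal_generated_add[OF assms(2) this] show ?thesis by simp
qed

lemma ideal_generated_trans:
  assumes A: "unital_subring A" and "p \<in> ideal_generated A S" and S: "S \<subseteq> ideal_generated A T"
  shows "p \<in> ideal_generated A T"
  using assms(2)
proof induction
  case (step p a s)
  have "a * s \<in> ideal_generated A T"
    using step S by (intro ideal_generated_mult[OF A]) auto
  with step.IH show ?case by (rule ideal_generated_add)
qed (rule ideal_generated.zero)

lemma ideal_generated_subset:
  assumes A: "unital_subring A" and "p \<in> ideal_generated A S" and "S \<subseteq> A"
  shows "p \<in> A"
  using assms(2)
  by induction (use assms(3) in \<open>auto intro!: unital_subring_closed[OF A]\<close>)

lemma ideal_generated_finite_support:
  assumes "p \<in> ideal_generated A S"
  shows "\<exists>F\<subseteq>S. finite F \<and> p \<in> ideal_generated A F"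
  using assms
proof induction
  case zero
  show ?case by (rule exI[of _ "{}"]) (simp add: ideal_generated.zero)
next
  case (step p a s)
  then obtain F where F: "F \<subseteq> S" "finite F" "p \<in> ideal_generated A F" by blast
  have "p + a * s \<in> ideal_generated A (insert s F)"
    using F(3) step.hyps by (intro ideal_generated.step ideal_generated_mono[OF F(3)]) auto
  with F step.hyps show ?case by (intro exI[of _ "insert s F"]) auto
qed

lemma ideal_generated_finite_support_set:
  assumes "finite E" "E \<subseteq> ideal_generated A S"
  shows "\<exists>F\<subseteq>S. finite F \<and> E \<subseteq> ideal_generated A F"
  using assms
proof induction
  case empty
  then show ?case by blast
next
  case (insert p E)
  then obtain F where F: "F \<subseteq> S" "finite F" "E \<subseteq> ideal_generated A F" by auto
  obtain F' where F': "F' \<subseteq> S" "finite F'" "p \<in> ideal_generated A F'"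
    using ideal_generated_finite_support insert.prems by (metis insert_subset)
  have "insert p E \<subseteq> ideal_generated A (F \<union> F')"
    using F(3) F'(3) by (auto intro: ideal_generated_mono)
  with F F' show ?case by (intro exI[of _ "F \<union> F'"]) auto
qed

abbreviation polynomials_over :: "'r::comm_ring_1 set \<Rightarrow> 'r poly set" where
  "polynomials_over A \<equiv> {p. \<forall>i. coeff p i \<in> A}"

lemma unital_subring_polynomials_over:
  assumes A: "unital_subring A"
  shows "unital_subring (polynomials_over A)"
  unfolding unital_subring_def
  using unital_subring_closed[OF A]
  by (auto simp: coeff_mult intro!: unital_subring_sum[OF A])

text \<open>
  If the ideal \<open>I\<close> were not finitely generated, one could repeatedly adjoin an element of least degree
  among those of \<open>I\<close> not yet generated. The leading coefficient of some such element is a combination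
  of the earlier ones, and subtracting the corresponding combination of the earlier elements, which have
  no larger degree, gives a polynomial of smaller degree that is not yet generated either.
\<close>

theorem hilbert_basis:
  assumes A: "noetherian_subring A"
  shows "noetherian_subring (polynomials_over A)"
  unfolding noetherian_subring_def
proof (intro conjI allI impI)
  have ringA: "unital_subring A" using A by (simp add: noetherian_subring_def)
  define P where "P = polynomials_over A"
  have ringP: "unital_subring P"
    unfolding P_def by (rule unital_subring_polynomials_over[OF ringA])
  then show "unital_subring (polynomials_over A)" unfolding P_def .
  fix S assume "S \<subseteq> polynomials_over A"
  then have S: "S \<subseteq> P" unfolding P_def .
  define I where "I = ideal_generated P S"
  have IP: "I \<subseteq> P" using ideal_generated_subset[OF ringP _ S] by (auto simp: I_def)
  have "\<exists>F\<subseteq>I. finite F \<and> I \<subseteq> ideal_generated P F"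
  proof (rule ccontr)
    assume "\<not> ?thesis"
    then have ex: "\<exists>f. f \<in> I \<and> f \<notin> ideal_generated P F" if "F \<subseteq> I" "finite F" for F
      using that by blast
    have least: "\<exists>f. f \<in> I \<and> f \<notin> ideal_generated P F \<and>
        (\<forall>g. g \<in> I \<and> g \<notin> ideal_generated P F \<longrightarrow> degree f \<le> degree g)"
      if "F \<subseteq> I" "finite F" for F
      using ex[OF that]
        ex_has_least_nat[of "\<lambda>f. f \<in> I \<and> f \<notin> ideal_generated P F" _ degree] by blast
    then obtain pick where pick: "\<And>F. F \<subseteq> I \<Longrightarrow> finite F \<Longrightarrow> pick F \<in> I \<and>
        pick F \<notin> ideal_generated P F \<and>
        (\<forall>g. g \<in> I \<and> g \<notin> ideal_generated P F \<longrightarrow> degree (pick F) \<le> degree g)"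
      by metis
    \<comment> \<open>\<open>E n\<close> consists of the first \<open>n\<close> polynomials picked, and \<open>f n\<close> is the next one.\<close>
    define E where "E n = ((\<lambda>F. insert (pick F) F) ^^ n) {}" for n
    define f where "f n = pick (E n)" for n
    have E_Suc: "E (Suc n) = insert (f n) (E n)" for n by (simp add: E_def f_def)
    have E: "E n \<subseteq> I \<and> finite (E n)" for n
    proof (induction n)
      case 0
      show ?case by (simp add: E_def)
    next
      case (Suc n)
      then show ?case using pick[of "E n"] unfolding E_Suc f_def by auto
    qed
    have E_eq: "E n = f ` {..<n}" for n
      by (induction n) (simp_all add: E_Suc lessThan_Suc, simp add: E_def)
    have f: "f n \<in> I" "f n \<notin> ideal_generated P (E n)"
      "\<And>g. g \<in> I \<Longrightarrow> g \<notin> ideal_generated P (E n) \<Longrightarrow> degree (f n) \<le> degree g" for n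
      using pick[of "E n"] E[of n] unfolding f_def by blast+
    have deg: "degree (f i) \<le> degree (f n)" if "i < n" for i n
    proof (rule f(3))
      have "E i \<subseteq> E n" using that by (auto simp: E_eq)
      then show "f n \<notin> ideal_generated P (E i)" using f(2)[of n] ideal_generated_mono by blast
    qed (rule f)
    define a where "a n = lead_coeff (f n)" for n
    have "range a \<subseteq> A" using f(1) IP by (auto simp: a_def P_def)
    then obtain H where H: "H \<subseteq> range a" "finite H" "range a \<subseteq> ideal_generated A H"
      using A unfolding noetherian_subring_def by meson
    obtain J where J: "finite J" "H = a ` J"
      using finite_subset_image[OF H(2,1)] by blast
    define N where "N = Suc (Max (insert 0 J))"
    have "J \<subseteq> {..<N}" using J(1) by (auto simp: N_def less_Suc_eq_le)
    have "a N \<in> ideal_generated A H" using H(3) by blast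
    then have "a N \<in> ideal_generated A (a ` {..<N})"
      by (rule ideal_generated_mono) (use \<open>J \<subseteq> {..<N}\<close> J(2) in auto)
    moreover have "\<exists>q\<in>ideal_generated P (E N). coeff q (degree (f N)) = c \<and> degree q \<le> degree (f N)"
      if "c \<in> ideal_generated A (a ` {..<N})" for c
      using that
    proof induction
      case zero
      show ?case by (rule bexI[of _ 0]) (simp_all add: ideal_generated.zero)
    next
      case (step c b s)
      then obtain q where q: "q \<in> ideal_generated P (E N)" "coeff q (degree (f N)) = c"
        "degree q \<le> degree (f N)" by blast
      obtain i where i: "i < N" "s = a i" using step.hyps by auto
      let ?m = "monom b (degree (f N) - degree (f i))"
      have "?m \<in> P" using step.hyps unital_subring_closed(1)[OF ringA] by (auto simp: P_def)
      then have mem: "q + ?m * f i \<in> ideal_generated P (E N)"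
        using q(1) i(1) by (intro ideal_generated.step) (auto simp: E_eq)
      have "coeff (?m * f i) (degree (f N)) = b * s"
        using deg[OF i(1)] i(2) by (simp add: coeff_monom_mult a_def)
      moreover have "degree (?m * f i) \<le> degree (f N)"
        using degree_mult_le[of ?m "f i"] degree_monom_le[of b "degree (f N) - degree (f i)"]
          deg[OF i(1)] by linarith
      ultimately show ?case using mem q(2,3)
        by (intro bexI[of _ "q + ?m * f i"]) (auto intro: degree_add_le)
    qed
    ultimately obtain q where q: "q \<in> ideal_generated P (E N)"
      "coeff q (degree (f N)) = a N" "degree q \<le> degree (f N)" by blast
    let ?g = "f N - q"
    have "q \<in> I"
      using ideal_generated_trans[OF ringP q(1), of S] E[of N] unfolding I_def by blast
    then have gI: "?g \<in> I"
      using f(1)[of N] ideal_generated_diff[OF ringP] unfolding I_def by blast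
    have gE: "?g \<notin> ideal_generated P (E N)"
      using ideal_generated_add[OF q(1), of ?g] f(2)[of N] by auto
    have "degree (f N) \<le> degree ?g" by (rule f(3)[OF gI gE])
    moreover have "degree ?g \<le> degree (f N)" by (rule degree_diff_le) (simp_all add: q)
    ultimately have "degree ?g = degree (f N)" by simp
    moreover have "coeff ?g (degree (f N)) = 0" using q(2) by (simp add: a_def)
    ultimately have "?g = 0" by (metis leading_coeff_0_iff)
    then show False using gE ideal_generated.zero by metis
  qed
  then obtain F where F: "F \<subseteq> I" "finite F" "I \<subseteq> ideal_generated P F" by blast
  obtain F' where F': "F' \<subseteq> S" "finite F'" "F \<subseteq> ideal_generated P F'"
    using ideal_generated_finite_support_set[OF F(2)] F(1) unfolding I_def by blast
  have "s \<in> ideal_generated P F'" if "s \<in> S" for s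
  proof -
    have "s \<in> I" unfolding I_def by (rule ideal_generated_generator[OF ringP that])
    then show ?thesis using ideal_generated_trans[OF ringP _ F'(3)] F(3) by blast
  qed
  then show "\<exists>F\<subseteq>S. finite F \<and> S \<subseteq> ideal_generated (polynomials_over A) F"
    using F' unfolding P_def by blast
qed

lemma noetherian_subring_image:
  assumes A: "noetherian_subring A"
    and h: "h 1 = 1" "\<And>a b. h (a - b) = h a - h b" "\<And>a b. h (a * b) = h a * h b"
  shows "noetherian_subring (h ` A)"
  unfolding noetherian_subring_def
proof (intro conjI allI impI)
  have ringA: "unital_subring A" using A by (simp add: noetherian_subring_def)
  then show "unital_subring (h ` A)"
    unfolding unital_subring_def by (auto simp flip: h)
  have h0: "h 0 = 0" using h(2)[of 0 0] by simp
  have hadd: "h (a + b) = h a + h b" for a b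
    using h(2)[of a "0 - b"] h(2)[of 0 b] h0 by simp
  fix S assume S: "S \<subseteq> h ` A"
  let ?T = "{a \<in> A. h a \<in> S}"
  have "\<exists>F\<subseteq>?T. finite F \<and> ?T \<subseteq> ideal_generated A F"
    using A unfolding noetherian_subring_def by (metis (lifting) mem_Collect_eq subsetI)
  then obtain F where F: "F \<subseteq> ?T" "finite F" "?T \<subseteq> ideal_generated A F" by blast
  have image: "h p \<in> ideal_generated (h ` A) (h ` F)" if "p \<in> ideal_generated A F" for p
    using that by induction (auto simp: h0 hadd h intro!: ideal_generated.intros)
  have "S \<subseteq> ideal_generated (h ` A) (h ` F)"
  proof
    fix s assume "s \<in> S"
    then obtain t where "t \<in> ?T" "s = h t" using S by auto
    then show "s \<in> ideal_generated (h ` A) (h ` F)" using image F(3) by blast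
  qed
  then show "\<exists>F\<subseteq>S. finite F \<and> S \<subseteq> ideal_generated (h ` A) F"
    using F(1,2) by (intro exI[of _ "h ` F"]) auto
qed

lemma unital_subring_subalgebra_generated:
  "unital_subring (subalgebra_generated F :: ('a \<Rightarrow> 'k::comm_ring_1) set)"
  unfolding unital_subring_def
proof (intro conjI ballI)
  show "1 \<in> subalgebra_generated F"
    using subalgebra_generated.const[of 1 F] by (simp add: one_fun_def)
  fix f g assume fg: "f \<in> subalgebra_generated F" "g \<in> subalgebra_generated F"
  show "f * g \<in> subalgebra_generated F"
    using subalgebra_generated.mult[OF fg] by (simp add: times_fun_def)
  have "(\<lambda>x. f x + (\<lambda>_. - 1) x * g x) \<in> subalgebra_generated F"
    by (intro subalgebra_generated.add subalgebra_generated.mult subalgebra_generated.const fg)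
  moreover have "(\<lambda>x. f x + (\<lambda>_. - 1) x * g x) = f - g" by (simp add: fun_eq_iff)
  ultimately show "f - g \<in> subalgebra_generated F" by simp
qed

lemma subalgebra_generated_insert:
  "subalgebra_generated (insert x F) =
     (\<lambda>p. poly p x) ` polynomials_over (subalgebra_generated F :: ('a \<Rightarrow> 'k::comm_ring_1) set)"
    (is "?L = ?R")
proof
  let ?A = "subalgebra_generated F"
  note ring = unital_subring_subalgebra_generated[of F]
  note ring_insert = unital_subring_subalgebra_generated[of "insert x F"]
  note ring_poly = unital_subring_polynomials_over[OF ring]
  have coefficient: "f \<in> ?R" if "f \<in> ?A" for f
  proof
    show "f = poly [:f:] x" by simp
    show "[:f:] \<in> polynomials_over ?A"
      using that unital_subring_closed(1)[OF ring] by (auto simp: coeff_pCons split: nat.split)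
  qed
  show "?L \<subseteq> ?R"
  proof
    fix f assume "f \<in> ?L"
    then show "f \<in> ?R"
    proof induction
      case (generator f)
      have "x \<in> ?R"
      proof
        show "x = poly [:0, 1:] x" by simp
        show "[:0, 1:] \<in> polynomials_over ?A"
          using unital_subring_closed(1,2)[OF ring] by (auto simp: coeff_pCons split: nat.split)
      qed
      then show ?case using generator coefficient subalgebra_generated.generator by blast
    next
      case (const c)
      show ?case by (intro coefficient subalgebra_generated.const)
    next
      case (add f g)
      then obtain p q where pq: "p \<in> polynomials_over ?A" "q \<in> polynomials_over ?A"
        "f = poly p x" "g = poly q x" by (auto simp: image_iff)
      have "(\<lambda>y. f y + g y) = poly (p + q) x" by (simp add: pq plus_fun_def)
      then show ?case using unital_subring_closed(6)[OF ring_poly pq(1,2)] by (rule image_eqI)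
    next
      case (mult f g)
      then obtain p q where pq: "p \<in> polynomials_over ?A" "q \<in> polynomials_over ?A"
        "f = poly p x" "g = poly q x" by (auto simp: image_iff)
      have "(\<lambda>y. f y * g y) = poly (p * q) x" by (simp add: pq times_fun_def)
      then show ?case using unital_subring_closed(4)[OF ring_poly pq(1,2)] by (rule image_eqI)
    qed
  qed
  have mono: "f \<in> ?L" if "f \<in> ?A" for f
    using that by induction (auto intro: subalgebra_generated.intros)
  have x: "x \<in> ?L" by (simp add: subalgebra_generated.generator)
  have "x ^ i \<in> ?L" for i
    by (induction i)
      (simp_all only: power_0 power_Suc unital_subring_closed[OF ring_insert] x)
  then show "?R \<subseteq> ?L"
    using mono
    by (auto simp: poly_altdef
        intro!: unital_subring_sum[OF ring_insert] unital_subring_closed(4)[OF ring_insert])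
qed

lemma noetherian_subalgebra_generated:
  assumes "finite F"
  shows "noetherian_subring (subalgebra_generated F :: ('a \<Rightarrow> 'k::field) set)"
  using assms
proof induction
  case empty
  let ?A = "subalgebra_generated {} :: ('a \<Rightarrow> 'k) set"
  have const: "\<exists>c. f = (\<lambda>_. c)" if "f \<in> ?A" for f
    using that by induction auto
  show ?case
    unfolding noetherian_subring_def
  proof (intro conjI allI impI unital_subring_subalgebra_generated)
    fix S assume S: "S \<subseteq> ?A"
    show "\<exists>F\<subseteq>S. finite F \<and> S \<subseteq> ideal_generated ?A F"
    proof (cases "S \<subseteq> {0}")
      case True
      then have "S \<subseteq> ideal_generated ?A {}" using ideal_generated.zero by blast
      then show ?thesis by (intro exI[of _ "{}"]) auto
    next
      case False
      then obtain s where s: "s \<in> S" "s \<noteq> 0" by blast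
      then obtain c where c: "s = (\<lambda>_. c)" using const S by blast
      then have "c \<noteq> 0" using s(2) by (auto simp: zero_fun_def)
      have "f \<in> ideal_generated ?A {s}" if "f \<in> S" for f
      proof -
        have "f \<in> ?A" using S that by blast
        from const[OF this] obtain d where d: "f = (\<lambda>_. d)" by blast
        have "0 + (\<lambda>_. d / c) * s \<in> ideal_generated ?A {s}"
          by (intro ideal_generated.intros subalgebra_generated.const) simp
        moreover have "0 + (\<lambda>_. d / c) * s = f" using \<open>c \<noteq> 0\<close> by (simp add: c d fun_eq_iff)
        ultimately show ?thesis by simp
      qed
      then show ?thesis using s(1) by (intro exI[of _ "{s}"]) auto
    qed
  qed
next
  case (insert x F)
  show ?case unfolding subalgebra_generated_insert
    by (intro noetherian_subring_image hilbert_basis insert.IH) auto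
qed

text \<open>
  Each \<open>f n\<close> lies outside every ideal generated by the others, because all of these vanish at a point
  where \<open>f n\<close> does not.
\<close>

lemma noetherian_no_orthogonal_sequence:
  fixes A :: "('a \<Rightarrow> 'k::comm_ring_1) set"
  assumes A: "noetherian_subring A" and f: "\<And>n. f n \<in> A"
    and nonzero: "\<And>n::nat. f n (x n) \<noteq> 0" and orthogonal: "\<And>m n. m \<noteq> n \<Longrightarrow> f m (x n) = 0"
  shows False
proof -
  have "inj f" by (rule injI) (metis nonzero orthogonal)
  then have "infinite (range f)" by (simp add: finite_image_iff)
  have "range f \<subseteq> A" using f by blast
  then obtain F where F: "F \<subseteq> range f" "finite F" "range f \<subseteq> ideal_generated A F"
    using A unfolding noetherian_subring_def by meson
  then obtain n where n: "f n \<notin> F"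
    using \<open>infinite (range f)\<close> finite_subset[of "range f" F] by blast
  have "g (x n) = 0" if "g \<in> ideal_generated A F" for g
    using that
  proof induction
    case (step p a s)
    then obtain m where "s = f m" "m \<noteq> n" using F(1) n by blast
    with step.IH show ?case by (simp add: orthogonal)
  qed simp
  then show False using F(3) nonzero by blast
qed


section \<open>Connected homogeneous spaces\<close>

text \<open>
  Irreducibility of the subspace \<open>W\<close>, expressed by the open sets of \<open>X\<close>.
\<close>

definition irreducible_open :: "'a topology \<Rightarrow> 'a set \<Rightarrow> bool" where
  "irreducible_open X W \<longleftrightarrow> openin X W \<and> W \<noteq> {} \<and>
     (\<forall>U V. openin X U \<longrightarrow> openin X V \<longrightarrow> U \<inter> W \<noteq> {} \<longrightarrow> V \<inter> W \<noteq> {} \<longrightarrow> U \<inter> V \<inter> W \<noteq> {})"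

lemma irreducible_openD:
  assumes "irreducible_open X W"
  shows "openin X W" "W \<noteq> {}"
    and "openin X U \<Longrightarrow> openin X V \<Longrightarrow> U \<inter> W \<noteq> {} \<Longrightarrow> V \<inter> W \<noteq> {} \<Longrightarrow> U \<inter> V \<inter> W \<noteq> {}"
  using assms unfolding irreducible_open_def by blast+

text \<open>
  Otherwise every nonempty open set contains two disjoint nonempty open sets; keeping one and splitting
  the other again produces infinitely many disjoint ones.
\<close>

lemma irreducible_open_exists:
  assumes no_seq: "\<nexists>D :: nat \<Rightarrow> 'a set. disjoint_family D \<and> (\<forall>n. openin X (D n) \<and> D n \<noteq> {})"
    and "topspace X \<noteq> {}"
  shows "\<exists>W. irreducible_open X W"
proof (rule ccontr)
  assume no: "\<not> ?thesis"
  have "\<exists>D E. openin X D \<and> D \<noteq> {} \<and> D \<subseteq> W \<and> openin X E \<and> E \<noteq> {} \<and> E \<subseteq> W \<and> D \<inter> E = {}"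
    if W: "openin X W" "W \<noteq> {}" for W
  proof -
    obtain U V where UV: "openin X U" "openin X V" "U \<inter> W \<noteq> {}" "V \<inter> W \<noteq> {}" "U \<inter> V \<inter> W = {}"
    proof -
      have "\<not> irreducible_open X W" using no by simp
      then show ?thesis using W that unfolding irreducible_open_def by auto
    qed
    then show ?thesis
      using W(1) by (intro exI[of _ "U \<inter> W"] exI[of _ "V \<inter> W"]) (auto intro: openin_Int)
  qed
  then obtain d e where de: "\<And>W. openin X W \<Longrightarrow> W \<noteq> {} \<Longrightarrow> openin X (d W) \<and> d W \<noteq> {} \<and> d W \<subseteq> W \<and>
      openin X (e W) \<and> e W \<noteq> {} \<and> e W \<subseteq> W \<and> d W \<inter> e W = {}"
    by metis
  define W where "W n = (e ^^ n) (topspace X)" for n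
  have W_Suc: "W (Suc n) = e (W n)" for n by (simp add: W_def)
  have W: "openin X (W n) \<and> W n \<noteq> {}" for n
  proof (induction n)
    case 0
    show ?case using assms(2) by (simp add: W_def)
  next
    case (Suc n)
    then show ?case using de[of "W n"] by (simp add: W_Suc)
  qed
  have "W (Suc n) \<subseteq> W n" for n using de[of "W n"] W[of n] by (simp add: W_Suc)
  then have decreasing: "W n \<subseteq> W m" if "m \<le> n" for m n using lift_Suc_antimono_le[of W] that by blast
  have disjoint: "d (W m) \<inter> d (W n) = {}" if "m < n" for m n
  proof -
    have "d (W n) \<subseteq> W n" using de[of "W n"] W[of n] by blast
    also have "\<dots> \<subseteq> e (W m)" using decreasing[of "Suc m" n] that by (simp add: W_Suc)
    finally show ?thesis using de[of "W m"] W[of m] by blast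
  qed
  have "disjoint_family (\<lambda>n. d (W n))"
    unfolding disjoint_family_on_def
  proof (intro ballI impI)
    fix m n :: nat
    assume "m \<noteq> n"
    then show "d (W m) \<inter> d (W n) = {}"
      using disjoint[of m n] disjoint[of n m] by (cases m n rule: linorder_cases) auto
  qed
  moreover have "openin X (d (W n)) \<and> d (W n) \<noteq> {}" for n using de[of "W n"] W[of n] by simp
  ultimately show False using no_seq by auto
qed

lemma irreducible_open_homeomorphic_image:
  assumes h: "homeomorphic_map X X h" and W: "irreducible_open X W"
  shows "irreducible_open X (h ` W)"
  unfolding irreducible_open_def
proof (intro conjI allI impI)
  note W = irreducible_openD[OF W]
  have sub: "W \<subseteq> topspace X" using W(1) by (rule openin_subset)
  show "openin X (h ` W)" using homeomorphic_map_openness[OF h sub] W(1) by simp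
  show "h ` W \<noteq> {}" using W(2) by simp
  fix U V assume UV: "openin X U" "openin X V" "U \<inter> h ` W \<noteq> {}" "V \<inter> h ` W \<noteq> {}"
  let ?pre = "\<lambda>U. {x \<in> topspace X. h x \<in> U}"
  have "continuous_map X X h" using h by (rule homeomorphic_imp_continuous_map)
  then have "openin X (?pre U)" "openin X (?pre V)"
    using UV by (auto intro: openin_continuous_map_preimage)
  moreover have "?pre U \<inter> W \<noteq> {}" "?pre V \<inter> W \<noteq> {}" using UV sub by auto
  ultimately have "?pre U \<inter> ?pre V \<inter> W \<noteq> {}" by (rule W)
  then show "U \<inter> V \<inter> h ` W \<noteq> {}" by auto
qed

text \<open>
  The union \<open>M\<close> of the irreducible open sets that meet a given one \<open>W\<close> is irreducible, since each of
  these shares a dense open subset with \<open>W\<close>. By homogeneity the irreducible open sets cover the space,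
  and one that meets \<open>M\<close> meets \<open>W\<close>. Hence \<open>M\<close> is closed as well, and it is the whole space.
\<close>

theorem connected_homogeneous_irreducible:
  assumes connected: "connected_space X"
    and homogeneous: "\<And>x y. x \<in> topspace X \<Longrightarrow> y \<in> topspace X \<Longrightarrow> \<exists>h. homeomorphic_map X X h \<and> h x = y"
    and no_seq: "\<nexists>D :: nat \<Rightarrow> 'a set. disjoint_family D \<and> (\<forall>n. openin X (D n) \<and> D n \<noteq> {})"
    and nonempty: "topspace X \<noteq> {}"
  shows "irreducible_open X (topspace X)"
proof -
  obtain W where W: "irreducible_open X W"
    using irreducible_open_exists[OF no_seq nonempty] by blast
  define M where "M = \<Union>{V. irreducible_open X V \<and> V \<inter> W \<noteq> {}}"
  have meets_W: "U \<inter> W \<noteq> {}" if "openin X U" "irreducible_open X V" "V \<inter> W \<noteq> {}" "U \<inter> V \<noteq> {}" for U V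
    using irreducible_openD(3)[OF that(2,1) irreducible_openD(1)[OF W]] that(3,4) by blast
  have M_open: "openin X M" unfolding M_def using irreducible_openD(1) by blast
  have W_sub: "W \<subseteq> M" unfolding M_def using W irreducible_openD(2)[OF W] by blast
  have "openin X (topspace X - M)"
  proof (subst openin_subopen, intro ballI)
    fix x assume x: "x \<in> topspace X - M"
    obtain w where w: "w \<in> W" using irreducible_openD(2)[OF W] by blast
    then have "w \<in> topspace X" using openin_subset irreducible_openD(1)[OF W] by blast
    then obtain h where h: "homeomorphic_map X X h" "h w = x" using homogeneous x by blast
    let ?V = "h ` W"
    have V: "irreducible_open X ?V" by (rule irreducible_open_homeomorphic_image[OF h(1) W])
    have xV: "x \<in> ?V" using w h(2) by blast
    have "?V \<inter> M = {}"
    proof (rule ccontr)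
      assume "?V \<inter> M \<noteq> {}"
      then have "?V \<inter> W \<noteq> {}"
        using meets_W irreducible_openD(1)[OF V] unfolding M_def by blast
      then have "?V \<subseteq> M" using V unfolding M_def by blast
      then show False using x xV by blast
    qed
    then show "\<exists>T. openin X T \<and> x \<in> T \<and> T \<subseteq> topspace X - M"
      using irreducible_openD(1)[OF V] xV openin_subset by (intro exI[of _ ?V]) blast
  qed
  then have "closedin X M" using M_open by (simp add: closedin_def openin_subset)
  then have M: "M = topspace X"
    using connected M_open W_sub irreducible_openD(2)[OF W]
    unfolding connected_space_clopen_in by blast
  show ?thesis
    unfolding irreducible_open_def
  proof (intro conjI allI impI nonempty openin_topspace)
    fix U V assume UV: "openin X U" "openin X V" "U \<inter> topspace X \<noteq> {}" "V \<inter> topspace X \<noteq> {}"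
    then have "U \<inter> W \<noteq> {}" "V \<inter> W \<noteq> {}" using meets_W unfolding M[symmetric] M_def by blast+
    then have "U \<inter> V \<inter> W \<noteq> {}" by (rule irreducible_openD(3)[OF W UV(1,2)])
    then show "U \<inter> V \<inter> topspace X \<noteq> {}" using W_sub M by blast
  qed
qed

lemma irreducible_open_finite_Inter:
  assumes X: "irreducible_open X (topspace X)" and "finite \<U>"
    and "\<And>U. U \<in> \<U> \<Longrightarrow> openin X U \<and> U \<noteq> {}"
  shows "openin X (topspace X \<inter> \<Inter>\<U>) \<and> topspace X \<inter> \<Inter>\<U> \<noteq> {}"
  using assms(2,3)
proof induction
  case empty
  show ?case using irreducible_openD(1,2)[OF X] by simp
next
  case (insert U \<U>)
  let ?V = "topspace X \<inter> \<Inter>\<U>"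
  have U: "openin X U" "U \<noteq> {}" and V: "openin X ?V" "?V \<noteq> {}" using insert by simp_all
  have "U \<subseteq> topspace X" using U(1) by (rule openin_subset)
  then have "U \<inter> ?V \<inter> topspace X \<noteq> {}"
    using irreducible_openD(3)[OF X U(1) V(1)] U(2) V(2) by blast
  moreover have "topspace X \<inter> \<Inter>(insert U \<U>) = U \<inter> ?V" by blast
  ultimately show ?case using openin_Int[OF U(1) V(1)] by auto
qed


section \<open>The Zariski topology of a linear algebraic group\<close>

lemma subgroup_GL_mult: "subgroup R GL \<Longrightarrow> s \<in> R \<Longrightarrow> t \<in> R \<Longrightarrow> s ** t \<in> R"
  using subgroup.m_closed[of R GL] by (simp add: GL_def)

lemma subgroup_GL_one: "subgroup R GL \<Longrightarrow> mat 1 \<in> R"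
  using subgroup.one_closed[of R GL] by (simp add: GL_def)

lemma subalgebra_generated_linear_combination:
  fixes F :: "'i \<Rightarrow> 'a \<Rightarrow> 'k::comm_ring_1"
  assumes "\<And>i. i \<in> I \<Longrightarrow> F i \<in> subalgebra_generated S"
  shows "(\<lambda>x. \<Sum>i\<in>I. c i * F i x) \<in> subalgebra_generated S"
  using assms
proof (induction I rule: infinite_finite_induct)
  case (insert i I)
  then have "(\<lambda>x. (\<lambda>_. c i) x * F i x + (\<Sum>i\<in>I. c i * F i x)) \<in> subalgebra_generated S"
    by (intro subalgebra_generated.add subalgebra_generated.mult subalgebra_generated.const) auto
  then show ?case using insert.hyps by simp
qed (simp_all add: subalgebra_generated.const)

lemma openin_zariski:
  assumes "G \<subseteq> carrier GL"
  shows "openin (zariski G) U \<longleftrightarrow> (\<exists>F\<subseteq>GL_coordinate_ring. U = {A \<in> G. \<exists>f\<in>F. f A \<noteq> 0})"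
proof
  assume "openin (zariski G) U"
  then obtain T where T: "openin zariski_GL T" "U = T \<inter> G" unfolding openin_subtopology by blast
  obtain F where F: "F \<subseteq> GL_coordinate_ring" "T = {A \<in> carrier GL. \<exists>f\<in>F. f A \<noteq> 0}"
    using T(1) unfolding openin_zariski_GL by blast
  then have "U = {A \<in> G. \<exists>f\<in>F. f A \<noteq> 0}" using T(2) assms by blast
  with F(1) show "\<exists>F\<subseteq>GL_coordinate_ring. U = {A \<in> G. \<exists>f\<in>F. f A \<noteq> 0}" by blast
next
  assume "\<exists>F\<subseteq>GL_coordinate_ring. U = {A \<in> G. \<exists>f\<in>F. f A \<noteq> 0}"
  then obtain F where F: "F \<subseteq> GL_coordinate_ring" "U = {A \<in> G. \<exists>f\<in>F. f A \<noteq> 0}" by blast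
  let ?T = "{A \<in> carrier GL. \<exists>f\<in>F. f A \<noteq> 0}"
  have "openin zariski_GL ?T" using F(1) unfolding openin_zariski_GL by blast
  moreover have "U = ?T \<inter> G" using F(2) assms by blast
  ultimately show "openin (zariski G) U" unfolding openin_subtopology by blast
qed

lemma topspace_zariski:
  fixes G :: "('k::field ^'n^'n) set"
  assumes "G \<subseteq> carrier GL"
  shows "topspace (zariski G) = G"
proof
  let ?F = "{\<lambda>_ :: 'k^'n^'n. 1 :: 'k}"
  have "(\<lambda>_. 1 :: 'k) \<in> GL_coordinate_ring"
    unfolding GL_coordinate_ring_def by (rule subalgebra_generated.const)
  then have "?F \<subseteq> GL_coordinate_ring \<and> G = {A \<in> G. \<exists>f\<in>?F. f A \<noteq> 0}" by auto
  then have "openin (zariski G) G" unfolding openin_zariski[OF assms] by (rule exI)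
  then show "G \<subseteq> topspace (zariski G)" by (rule openin_subset)
qed simp

lemma GL_coordinate_ring_translate:
  fixes g :: "'k::field ^'n^'n"
  assumes "f \<in> GL_coordinate_ring"
  shows "(\<lambda>A. f (g ** A)) \<in> GL_coordinate_ring"
  using assms unfolding GL_coordinate_ring_def
proof induction
  case (generator f)
  let ?S = "subalgebra_generated (insert (\<lambda>A. inverse (det A)) {\<lambda>A :: 'k^'n^'n. A $ i $ j | i j. True})"
  consider "f = (\<lambda>A. inverse (det A))" | i j where "f = (\<lambda>A. A $ i $ j)" using generator by blast
  then show ?case
  proof cases
    case 1
    have "(\<lambda>A. inverse (det g) * inverse (det A)) \<in> ?S"
      by (intro subalgebra_generated.mult subalgebra_generated.const subalgebra_generated.generator)
        simp
    then show ?thesis by (simp add: 1 det_mul)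
  next
    case 2
    have "(\<lambda>A. \<Sum>k\<in>UNIV. g $ i $ k * A $ k $ j) \<in> ?S"
      by (rule subalgebra_generated_linear_combination, rule subalgebra_generated.generator) blast
    then show ?thesis by (simp add: 2 matrix_matrix_mult_def)
  qed
next
  case (const c)
  show ?case by (rule subalgebra_generated.const)
next
  case (add f f')
  show ?case by (rule subalgebra_generated.add) (rule add.IH)+
next
  case (mult f f')
  show ?case by (rule subalgebra_generated.mult) (rule mult.IH)+
qed

lemma zariski_translation_continuous:
  assumes G: "subgroup G GL" and g: "g \<in> G"
  shows "continuous_map (zariski G) (zariski G) ((**) g)"
proof -
  have sub: "G \<subseteq> carrier GL" using G by (rule subgroup.subset)
  have "openin (zariski G) {A \<in> G. g ** A \<in> U}" if U: "openin (zariski G) U" for U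
  proof -
    obtain F where F: "F \<subseteq> GL_coordinate_ring" "U = {A \<in> G. \<exists>f\<in>F. f A \<noteq> 0}"
      using U unfolding openin_zariski[OF sub] by (elim exE conjE) (rule that)
    let ?F = "(\<lambda>f A. f (g ** A)) ` F"
    have "?F \<subseteq> GL_coordinate_ring" using F(1) GL_coordinate_ring_translate by blast
    moreover have "{A \<in> G. g ** A \<in> U} = {A \<in> G. \<exists>f\<in>?F. f A \<noteq> 0}"
      using F(2) subgroup_GL_mult[OF G g] by auto
    ultimately show ?thesis unfolding openin_zariski[OF sub] by (intro exI conjI)
  qed
  then show ?thesis
    using subgroup_GL_mult[OF G g] unfolding continuous_map_def topspace_zariski[OF sub] by auto
qed

lemma zariski_homogeneous:
  assumes G: "subgroup G GL" and xy: "x \<in> G" "y \<in> G"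
  shows "\<exists>h. homeomorphic_map (zariski G) (zariski G) h \<and> h x = y"
proof -
  have sub: "G \<subseteq> carrier GL" using G by (rule subgroup.subset)
  have inverse: "\<exists>b\<in>G. a ** b = mat 1 \<and> b ** a = mat 1" if a: "a \<in> G" for a
  proof -
    have inv: "invertible a" using a sub by (auto simp: GL_def)
    have "inv\<^bsub>GL\<^esub> a \<in> G" using G a by (rule subgroup.m_inv_closed)
    moreover have "a ** inv\<^bsub>GL\<^esub> a = mat 1 \<and> inv\<^bsub>GL\<^esub> a ** a = mat 1"
    proof -
      have "\<exists>!b. b \<in> carrier GL \<and> a ** b = mat 1 \<and> b ** a = mat 1"
        using inv unfolding invertible_def GL_def
        by simp (metis matrix_mul_assoc matrix_mul_lid matrix_mul_rid)
      from theI'[OF this] show ?thesis unfolding m_inv_def by (simp add: GL_def)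
    qed
    ultimately show ?thesis by blast
  qed
  obtain x' y' where x': "x' \<in> G" "x ** x' = mat 1" "x' ** x = mat 1"
    and y': "y' \<in> G" "y ** y' = mat 1" "y' ** y = mat 1"
    using inverse xy by metis
  let ?g = "y ** x'" and ?h = "x ** y'"
  have gh: "?g \<in> G" "?h \<in> G" using subgroup_GL_mult[OF G] xy x'(1) y'(1) by blast+
  have inv: "?g ** (?h ** A) = A" "?h ** (?g ** A) = A" for A
    by (metis matrix_mul_assoc matrix_mul_lid x' y')+
  have "homeomorphic_maps (zariski G) (zariski G) ((**) ?g) ((**) ?h)"
    unfolding homeomorphic_maps_def
    using zariski_translation_continuous[OF G] gh inv by blast
  moreover have "?g ** x = y" by (metis matrix_mul_assoc matrix_mul_rid x'(3))
  ultimately show ?thesis using homeomorphic_maps_map by blast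
qed

lemma noetherian_GL_coordinate_ring:
  "noetherian_subring (GL_coordinate_ring :: ('k::field ^'n^'n \<Rightarrow> 'k) set)"
proof -
  have "{\<lambda>A :: 'k^'n^'n. A $ i $ j | i j. True} = (\<lambda>(i, j) A. A $ i $ j) ` UNIV" by auto
  then have "finite {\<lambda>A :: 'k^'n^'n. A $ i $ j | i j. True}" by simp
  then show ?thesis
    unfolding GL_coordinate_ring_def by (intro noetherian_subalgebra_generated) simp
qed

text \<open>
  Regular functions whose nonvanishing loci lie in different members of a disjoint family have pairwise
  product zero.
\<close>

lemma zariski_no_disjoint_sequence:
  fixes G :: "('k::field ^'n^'n) set"
  assumes "G \<subseteq> carrier GL"
  shows "\<nexists>D :: nat \<Rightarrow> _. disjoint_family D \<and> (\<forall>n. openin (zariski G) (D n) \<and> D n \<noteq> {})"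
proof
  assume "\<exists>D :: nat \<Rightarrow> _. disjoint_family D \<and> (\<forall>n. openin (zariski G) (D n) \<and> D n \<noteq> {})"
  then obtain D :: "nat \<Rightarrow> _" where D: "disjoint_family D" "\<And>n. openin (zariski G) (D n)" "\<And>n. D n \<noteq> {}"
    by blast
  have "\<exists>f x. f \<in> GL_coordinate_ring \<and> x \<in> D n \<and> f x \<noteq> 0 \<and> (\<forall>y\<in>G. f y \<noteq> 0 \<longrightarrow> y \<in> D n)" for n
  proof -
    obtain F where F: "F \<subseteq> GL_coordinate_ring" "D n = {A \<in> G. \<exists>f\<in>F. f A \<noteq> 0}"
      using D(2)[of n] unfolding openin_zariski[OF assms] by (elim exE conjE) (rule that)
    obtain x where x: "x \<in> D n" using D(3)[of n] by blast
    then obtain f where "f \<in> F" "f x \<noteq> 0" using F(2) by blast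
    with F x show ?thesis by (intro exI[of _ f] exI[of _ x]) blast
  qed
  then obtain f x where f: "\<And>n. f n \<in> GL_coordinate_ring" and x: "\<And>n. x n \<in> D n"
    and nonzero: "\<And>n. f n (x n) \<noteq> 0" and supp: "\<And>n y. y \<in> G \<Longrightarrow> f n y \<noteq> 0 \<Longrightarrow> y \<in> D n"
    by metis
  have "D n \<subseteq> G" for n using openin_subset[OF D(2)[of n]] topspace_zariski[OF assms] by simp
  then have "f m (x n) = 0" if "m \<noteq> n" for m n
    using supp[of "x n" m] x[of n] D(1) that unfolding disjoint_family_on_def by blast
  with noetherian_GL_coordinate_ring f nonzero show False
    by (rule noetherian_no_orthogonal_sequence)
qed

theorem connected_linear_algebraic_group_irreducible:
  assumes G: "linear_algebraic_group G" and "connected_space (zariski G)"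
  shows "irreducible_open (zariski G) (topspace (zariski G))"
proof (rule connected_homogeneous_irreducible)
  have sub: "subgroup G GL" using G by (simp add: linear_algebraic_group_def)
  then have GL: "G \<subseteq> carrier GL" by (rule subgroup.subset)
  show "topspace (zariski G) \<noteq> {}"
    using subgroup_GL_one[OF sub] topspace_zariski[OF GL] by blast
  show "\<exists>h. homeomorphic_map (zariski G) (zariski G) h \<and> h x = y"
    if "x \<in> topspace (zariski G)" "y \<in> topspace (zariski G)" for x y
    using zariski_homogeneous[OF sub] that topspace_zariski[OF GL] by blast
  show "\<nexists>D :: nat \<Rightarrow> _. disjoint_family D \<and> (\<forall>n. openin (zariski G) (D n) \<and> D n \<noteq> {})"
    by (rule zariski_no_disjoint_sequence[OF GL])
qed (rule assms(2))

text \<open>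
  A vector is nonzero if and only if one of its coordinates in a basis of the whole space is, and each
  coordinate is a regular function of \<open>g\<close>. The basis may be infinite, since arbitrary unions of
  nonvanishing loci are open.
\<close>

lemma openin_zariski_nonvanishing:
  assumes V: "vector_space scl" and G: "G \<subseteq> carrier GL"
    and F: "\<And>b. b \<in> B \<Longrightarrow> F b \<in> GL_coordinate_ring"
  shows "openin (zariski G) {g \<in> G. (\<Sum>b\<in>B. scl (F b g) (w b)) \<noteq> 0}"
proof -
  interpret V: vector_space scl by (rule V)
  obtain E where E: "V.independent E" "V.span E = UNIV"
    by (rule V.basis_exists[of UNIV]) (rule that, auto)
  let ?f = "\<lambda>e g. \<Sum>b\<in>B. V.representation E (w b) e * F b g"
  have mem: "?f e \<in> GL_coordinate_ring" for e
    using F unfolding GL_coordinate_ring_def by (rule subalgebra_generated_linear_combination)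
  have coordinate: "V.representation E (\<Sum>b\<in>B. scl (F b g) (w b)) e = ?f e g" for e g
    using E by (simp add: V.representation_sum V.representation_scale mult.commute)
  have "(\<Sum>b\<in>B. scl (F b g) (w b)) \<noteq> 0 \<longleftrightarrow> (\<exists>f\<in>range ?f. f g \<noteq> 0)" for g
  proof -
    have "u = 0 \<longleftrightarrow> (\<forall>e. V.representation E u e = 0)" for u
    proof
      assume "\<forall>e. V.representation E u e = 0"
      then have "(\<Sum>e | V.representation E u e \<noteq> 0. scl (V.representation E u e) e) = 0" by simp
      then show "u = 0" using V.sum_nonzero_representation_eq[OF E(1), of u] E(2) by simp
    qed (simp add: V.representation_zero)
    then show ?thesis by (simp add: coordinate)
  qed
  moreover have "range ?f \<subseteq> GL_coordinate_ring" using mem by blast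
  ultimately show ?thesis unfolding openin_zariski[OF G] by (intro exI[of _ "range ?f"]) simp
qed


section \<open>Characters of a torus\<close>

text \<open>
  Artin's argument: replacing \<open>t\<close> by \<open>m s t\<close> and subtracting \<open>\<theta>\<^sub>0 s\<close> times the original relation
  eliminates the character \<open>\<theta>\<^sub>0\<close> and multiplies the coefficient of each other \<open>\<theta>\<close> by
  \<open>\<theta> s - \<theta>\<^sub>0 s\<close>, which is nonzero for some \<open>s\<close>. Extensionality is what makes different
  characters differ at a point of \<open>R\<close>.
\<close>

lemma characters_independent:
  fixes w :: "('g \<Rightarrow> 'k::field) \<Rightarrow> 'v::ab_group_add"
  assumes V: "vector_space scl"
    and R: "R \<noteq> {}" "\<And>s t. s \<in> R \<Longrightarrow> t \<in> R \<Longrightarrow> m s t \<in> R"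
    and "finite C"
    and C: "\<And>\<theta>. \<theta> \<in> C \<Longrightarrow> \<theta> \<in> extensional R"
      "\<And>\<theta> t. \<theta> \<in> C \<Longrightarrow> t \<in> R \<Longrightarrow> \<theta> t \<noteq> 0"
      "\<And>\<theta> s t. \<theta> \<in> C \<Longrightarrow> s \<in> R \<Longrightarrow> t \<in> R \<Longrightarrow> \<theta> (m s t) = \<theta> s * \<theta> t"
    and zero: "\<And>t. t \<in> R \<Longrightarrow> (\<Sum>\<theta>\<in>C. scl (\<theta> t) (w \<theta>)) = 0"
    and "\<theta> \<in> C"
  shows "w \<theta> = 0"
  using \<open>finite C\<close> C zero \<open>\<theta> \<in> C\<close>
proof (induction C arbitrary: w \<theta> rule: finite_induct)
  case empty
  then show ?case by simp
next
  case (insert \<theta>\<^sub>0 C)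
  interpret V: vector_space scl by (rule V)
  have old: "w \<theta> = 0" if \<theta>: "\<theta> \<in> C" for \<theta>
  proof -
    have "\<theta> \<noteq> \<theta>\<^sub>0" using \<theta> insert.hyps by blast
    moreover have "\<theta> \<in> extensional R" "\<theta>\<^sub>0 \<in> extensional R" using insert.prems(1) \<theta> by auto
    ultimately obtain s where s: "s \<in> R" "\<theta> s \<noteq> \<theta>\<^sub>0 s" using extensionalityI by blast
    have "scl (\<theta> s - \<theta>\<^sub>0 s) (w \<theta>) = 0"
    proof (rule insert.IH[where w = "\<lambda>\<theta>. scl (\<theta> s - \<theta>\<^sub>0 s) (w \<theta>)"])
      fix t assume t: "t \<in> R"
      have "(\<Sum>\<theta>\<in>C. scl (\<theta> t) (scl (\<theta> s - \<theta>\<^sub>0 s) (w \<theta>)))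
          = (\<Sum>\<theta>\<in>insert \<theta>\<^sub>0 C. scl (\<theta> t) (scl (\<theta> s - \<theta>\<^sub>0 s) (w \<theta>)))"
        using insert.hyps by simp
      also have "\<dots> = (\<Sum>\<theta>\<in>insert \<theta>\<^sub>0 C. scl (\<theta> (m s t)) (w \<theta>) - scl (\<theta>\<^sub>0 s) (scl (\<theta> t) (w \<theta>)))"
        using s t insert.prems(3)
        by (intro sum.cong) (simp_all add: algebra_simps V.scale_left_diff_distrib)
      also have "\<dots> = (\<Sum>\<theta>\<in>insert \<theta>\<^sub>0 C. scl (\<theta> (m s t)) (w \<theta>))
          - scl (\<theta>\<^sub>0 s) (\<Sum>\<theta>\<in>insert \<theta>\<^sub>0 C. scl (\<theta> t) (w \<theta>))"
        by (simp add: sum_subtractf V.scale_sum_right del: sum.insert)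
      also have "\<dots> = 0"
        using insert.prems(4)[OF R(2)[OF s(1) t]] insert.prems(4)[OF t] by simp
      finally show "(\<Sum>\<theta>\<in>C. scl (\<theta> t) (scl (\<theta> s - \<theta>\<^sub>0 s) (w \<theta>))) = 0" .
    qed (use insert.prems \<theta> in auto)
    then show ?thesis using s(2) by simp
  qed
  obtain t where t: "t \<in> R" using R(1) by blast
  have "scl (\<theta>\<^sub>0 t) (w \<theta>\<^sub>0) = 0" using insert.prems(4)[OF t] insert.hyps old by simp
  then have "w \<theta>\<^sub>0 = 0" using insert.prems(2)[OF _ t, of \<theta>\<^sub>0] by simp
  then show ?case using old insert.prems(5) by auto
qed

lemma carrier_character_group:
  "\<theta> \<in> carrier (character_group R) \<longleftrightarrow> \<theta> \<in> extensional R \<and> \<theta> \<in> regular_functions R \<and>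
     (\<forall>t\<in>R. \<theta> t \<noteq> 0) \<and> (\<forall>s\<in>R. \<forall>t\<in>R. \<theta> (s ** t) = \<theta> s * \<theta> t)"
  by (auto simp: character_group_def)

text \<open>
  Vector values allow the same notion to serve for regular functions (with \<open>scl\<close> the multiplication
  of the field) and for orbit maps \<open>\<lambda>t. \<rho> t u\<close>.
\<close>

definition character_combination ::
  "('k \<Rightarrow> 'v \<Rightarrow> 'v) \<Rightarrow> ('k::field ^'n^'n) set \<Rightarrow> ('k^'n^'n \<Rightarrow> 'v::ab_group_add) \<Rightarrow> bool" where
  "character_combination scl R h \<longleftrightarrow> (\<exists>C w. finite C \<and> C \<subseteq> carrier (character_group R) \<and>
     (\<forall>t\<in>R. h t = (\<Sum>\<theta>\<in>C. scl (\<theta> t) (w \<theta>))))"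

lemma character_combination_cong:
  assumes "character_combination scl R h" and eq: "\<And>t. t \<in> R \<Longrightarrow> h t = h' t"
  shows "character_combination scl R h'"
proof -
  obtain C w where C: "finite C" "C \<subseteq> carrier (character_group R)"
    "\<forall>t\<in>R. h t = (\<Sum>\<theta>\<in>C. scl (\<theta> t) (w \<theta>))"
    using assms(1) unfolding character_combination_def by blast
  have "\<forall>t\<in>R. h' t = (\<Sum>\<theta>\<in>C. scl (\<theta> t) (w \<theta>))"
  proof
    fix t assume "t \<in> R"
    with C(3) eq[of t] show "h' t = (\<Sum>\<theta>\<in>C. scl (\<theta> t) (w \<theta>))" by simp
  qed
  with C(1,2) show ?thesis unfolding character_combination_def by blast
qed

lemma character_combination_character:
  "\<theta> \<in> carrier (character_group R) \<Longrightarrow> character_combination scl R (\<lambda>t. scl (\<theta> t) w)"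
  unfolding character_combination_def by (intro exI[of _ "{\<theta>}"] exI[of _ "\<lambda>_. w"]) simp

lemma character_combination_zero: "character_combination scl R (\<lambda>_. 0)"
  unfolding character_combination_def by (intro exI[of _ "{}"]) simp

lemma character_combination_add:
  assumes V: "vector_space scl" and "character_combination scl R h" "character_combination scl R h'"
  shows "character_combination scl R (\<lambda>t. h t + h' t)"
proof -
  interpret V: vector_space scl by (rule V)
  obtain C w where C: "finite C" "C \<subseteq> carrier (character_group R)"
    "\<And>t. t \<in> R \<Longrightarrow> h t = (\<Sum>\<theta>\<in>C. scl (\<theta> t) (w \<theta>))"
    using assms(2) unfolding character_combination_def by blast
  obtain C' w' where C': "finite C'" "C' \<subseteq> carrier (character_group R)"
    "\<And>t. t \<in> R \<Longrightarrow> h' t = (\<Sum>\<theta>\<in>C'. scl (\<theta> t) (w' \<theta>))"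
    using assms(3) unfolding character_combination_def by blast
  let ?w = "\<lambda>\<theta>. (if \<theta> \<in> C then w \<theta> else 0) + (if \<theta> \<in> C' then w' \<theta> else 0)"
  have "h t + h' t = (\<Sum>\<theta>\<in>C \<union> C'. scl (\<theta> t) (?w \<theta>))" if "t \<in> R" for t
  proof -
    have "(\<Sum>\<theta>\<in>C. scl (\<theta> t) (w \<theta>)) = (\<Sum>\<theta>\<in>C \<union> C'. scl (\<theta> t) (if \<theta> \<in> C then w \<theta> else 0))"
      using C(1) C'(1) by (intro sum.mono_neutral_cong_left) auto
    moreover have "(\<Sum>\<theta>\<in>C'. scl (\<theta> t) (w' \<theta>)) = (\<Sum>\<theta>\<in>C \<union> C'. scl (\<theta> t) (if \<theta> \<in> C' then w' \<theta> else 0))"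
      using C(1) C'(1) by (intro sum.mono_neutral_cong_left) auto
    ultimately show ?thesis
      by (simp only: C(3)[OF that] C'(3)[OF that] V.scale_right_distrib sum.distrib)
  qed
  then show ?thesis
    unfolding character_combination_def using C(1,2) C'(1,2)
    by (intro exI[of _ "C \<union> C'"] exI[of _ ?w]) blast
qed

lemma character_combination_sum:
  assumes V: "vector_space scl" and "\<And>i. i \<in> I \<Longrightarrow> character_combination scl R (h i)"
  shows "character_combination scl R (\<lambda>t. \<Sum>i\<in>I. h i t)"
  using assms(2)
proof (induction I rule: infinite_finite_induct)
  case (insert i I)
  have "character_combination scl R (\<lambda>t. h i t + (\<Sum>i\<in>I. h i t))"
    by (rule character_combination_add[OF V]) (simp_all add: insert)
  then show ?case using insert.hyps by simp
qed (simp_all add: character_combination_zero)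

lemma vector_space_mult: "vector_space ((*) :: 'k::field \<Rightarrow> 'k \<Rightarrow> 'k)"
  by unfold_locales (simp_all add: algebra_simps)

lemma character_group_mult_closed:
  assumes "\<theta> \<in> carrier (character_group R)" "\<psi> \<in> carrier (character_group R)"
    and R: "subgroup R GL"
  shows "restrict (\<lambda>t. \<theta> t * \<psi> t) R \<in> carrier (character_group R)"
proof -
  have "restrict (\<lambda>t. \<theta> t * \<psi> t) R \<in> regular_functions R"
  proof -
    obtain F G where "F \<in> GL_coordinate_ring" "\<forall>t\<in>R. \<theta> t = F t"
      "G \<in> GL_coordinate_ring" "\<forall>t\<in>R. \<psi> t = G t"
      using assms by (auto simp: carrier_character_group restrictions_def)
    then show ?thesis
      unfolding restrictions_def GL_coordinate_ring_def
      by (auto intro!: bexI[of _ "\<lambda>t. F t * G t"] subalgebra_generated.mult)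
  qed
  then show ?thesis
    using assms subgroup_GL_mult[OF R] by (auto simp: carrier_character_group)
qed

lemma character_combination_mult:
  assumes R: "subgroup R GL" and "character_combination (*) R f" "character_combination (*) R g"
  shows "character_combination (*) R (\<lambda>t. f t * g t)"
proof -
  obtain C a where C: "finite C" "C \<subseteq> carrier (character_group R)"
    "\<And>t. t \<in> R \<Longrightarrow> f t = (\<Sum>\<theta>\<in>C. \<theta> t * a \<theta>)"
    using assms(2) unfolding character_combination_def by blast
  obtain D b where D: "finite D" "D \<subseteq> carrier (character_group R)"
    "\<And>t. t \<in> R \<Longrightarrow> g t = (\<Sum>\<psi>\<in>D. \<psi> t * b \<psi>)"
    using assms(3) unfolding character_combination_def by blast
  have "character_combination (*) R (\<lambda>t. \<Sum>\<theta>\<in>C. \<Sum>\<psi>\<in>D. restrict (\<lambda>t. \<theta> t * \<psi> t) R t * (a \<theta> * b \<psi>))"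
    using C(2) D(2)
    by (intro character_combination_sum vector_space_mult character_combination_character
        character_group_mult_closed R) auto
  then show ?thesis
  proof (rule character_combination_cong)
    fix t assume t: "t \<in> R"
    show "(\<Sum>\<theta>\<in>C. \<Sum>\<psi>\<in>D. restrict (\<lambda>t. \<theta> t * \<psi> t) R t * (a \<theta> * b \<psi>)) = f t * g t"
      using t by (simp add: C(3) D(3) sum_product mult_ac)
  qed
qed

text \<open>
  The coordinates of a split torus and their inverses are characters, and products of characters are
  characters; so the combinations of characters already form an algebra that contains the generators of the
  coordinate ring.
\<close>

lemma regular_function_character_combination:
  assumes R: "torus R" and f: "f \<in> GL_coordinate_ring"
  shows "character_combination (*) R f"
proof -
  have sub: "subgroup R GL" using R unfolding torus_def linear_algebraic_group_def by (elim conjE)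
  obtain r \<phi> \<psi> where iso: "group_isomorphisms (GL\<lparr>carrier := R\<rparr>) (split_torus r) \<phi> \<psi>"
    and \<phi>: "\<forall>f\<in>split_torus_coordinate_ring r. f \<circ> \<phi> \<in> regular_functions R"
    and \<psi>: "\<forall>f\<in>GL_coordinate_ring.
       f \<circ> \<psi> \<in> restrictions (split_torus_coordinate_ring r) (carrier (split_torus r))"
    using R unfolding torus_def by (elim conjE exE) (rule that)
  have hom: "\<And>t. t \<in> R \<Longrightarrow> \<phi> t \<in> carrier (split_torus r)"
    "\<And>s t. s \<in> R \<Longrightarrow> t \<in> R \<Longrightarrow> \<phi> (s ** t) = (\<lambda>i. \<phi> s i * \<phi> t i)"
    "\<And>t. t \<in> R \<Longrightarrow> \<psi> (\<phi> t) = t"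
    using iso by (auto simp: group_isomorphisms_def hom_def GL_def split_torus_def)
  have character: "character_combination (*) R (\<lambda>t. h (\<phi> t) * c)"
    if h: "h \<in> split_torus_coordinate_ring r"
      "\<And>s t. h (\<lambda>i. s i * t i) = h s * h t" "\<And>s. s \<in> carrier (split_torus r) \<Longrightarrow> h s \<noteq> 0" for h c
  proof -
    let ?\<theta> = "restrict (h \<circ> \<phi>) R"
    have "?\<theta> \<in> regular_functions R" using bspec[OF \<phi> h(1)] by (auto simp: restrictions_def)
    then have "?\<theta> \<in> carrier (character_group R)"
      unfolding carrier_character_group
      by (auto simp: hom h subgroup_GL_mult[OF sub])
    then have "character_combination (*) R (\<lambda>t. ?\<theta> t * c)" by (rule character_combination_character)
    then show ?thesis by (rule character_combination_cong) simp
  qed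
  have "character_combination (*) R (h \<circ> \<phi>)" if "h \<in> split_torus_coordinate_ring r" for h
    using that unfolding split_torus_coordinate_ring_def
  proof induction
    case (generator h)
    then have mem: "h \<in> split_torus_coordinate_ring r"
      unfolding split_torus_coordinate_ring_def by (rule subalgebra_generated.generator)
    have "character_combination (*) R (\<lambda>t. h (\<phi> t) * 1)"
      by (rule character[OF mem]) (use generator in \<open>auto simp: split_torus_def\<close>)
    then show ?case by (simp add: comp_def)
  next
    case (const c)
    have "character_combination (*) R (\<lambda>t. (\<lambda>_. 1) (\<phi> t) * c)"
      by (rule character)
        (auto simp: split_torus_coordinate_ring_def intro: subalgebra_generated.const)
    then show ?case by (simp add: comp_def)
  next
    case (add f g)
    from character_combination_add[OF vector_space_mult add.IH] show ?case by (simp add: comp_def)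
  next
    case (mult f g)
    from character_combination_mult[OF sub mult.IH] show ?case by (simp add: comp_def)
  qed
  moreover obtain h where h: "h \<in> split_torus_coordinate_ring r"
    "\<And>s. s \<in> carrier (split_torus r) \<Longrightarrow> f (\<psi> s) = h s"
    using bspec[OF \<psi> f] by (auto simp: restrictions_def)
  ultimately have "character_combination (*) R (h \<circ> \<phi>)" by blast
  then show ?thesis
  proof (rule character_combination_cong)
    fix t assume "t \<in> R"
    then show "(h \<circ> \<phi>) t = f t" using h(2)[of "\<phi> t"] hom by simp
  qed
qed

lemma character_combination_scale:
  assumes V: "vector_space scl" and "character_combination (*) R f"
  shows "character_combination scl R (\<lambda>t. scl (f t) w)"
proof -
  interpret V: vector_space scl by (rule V)
  obtain C a where "finite C" "C \<subseteq> carrier (character_group R)"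
    "\<forall>t\<in>R. f t = (\<Sum>\<theta>\<in>C. \<theta> t * a \<theta>)"
    using assms(2) unfolding character_combination_def by blast
  then show ?thesis
    unfolding character_combination_def
    by (intro exI[of _ C] exI[of _ "\<lambda>\<theta>. scl (a \<theta>) w"]) (simp add: V.scale_sum_left)
qed


section \<open>Weight decompositions\<close>

text \<open>
  The property by which \<open>weight_decomposition\<close> selects its value, separated so that existence and
  uniqueness can be stated.
\<close>

definition is_weight_decomposition ::
  "('k \<Rightarrow> 'v \<Rightarrow> 'v) \<Rightarrow> ('k::field ^'n^'n \<Rightarrow> 'v \<Rightarrow> 'v) \<Rightarrow> ('k^'n^'n) set
     \<Rightarrow> 'v::ab_group_add \<Rightarrow> (('k^'n^'n \<Rightarrow> 'k) \<Rightarrow> 'v) \<Rightarrow> bool" where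
  "is_weight_decomposition scl \<rho> R u c \<longleftrightarrow>
     finite {\<theta>. c \<theta> \<noteq> 0} \<and>
     (\<forall>\<theta> \<in> carrier (character_group R). c \<theta> \<in> weight_space scl \<rho> R \<theta>) \<and>
     (\<forall>\<theta>. \<theta> \<notin> carrier (character_group R) \<longrightarrow> c \<theta> = 0) \<and>
     u = (\<Sum>\<theta> | c \<theta> \<noteq> 0. c \<theta>)"

context
  fixes scl :: "'k::field \<Rightarrow> 'v::ab_group_add \<Rightarrow> 'v" and G R :: "('k^'n^'n) set"
    and \<rho> :: "'k^'n^'n \<Rightarrow> 'v \<Rightarrow> 'v"
  assumes rep: "rational_representation scl G \<rho>"
    and G: "subgroup G GL" and torus: "torus R" and RG: "R \<subseteq> G"
begin

interpretation V: vector_space scl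
  using rep by (simp add: rational_representation_def)

lemma linear_action: "g \<in> G \<Longrightarrow> Vector_Spaces.linear scl scl (\<rho> g)"
  using rep by (simp add: rational_representation_def)

lemma action_sum: "g \<in> G \<Longrightarrow> \<rho> g (\<Sum>i\<in>I. w i) = (\<Sum>i\<in>I. \<rho> g (w i))"
  using module_hom.sum[OF module_hom_linearI[OF linear_action]] .

lemma action_scale: "g \<in> G \<Longrightarrow> \<rho> g (scl a w) = scl a (\<rho> g w)"
  using module_hom.scale[OF module_hom_linearI[OF linear_action]] .

lemma action_zero: "g \<in> G \<Longrightarrow> \<rho> g 0 = 0"
  using action_sum[of g _ "{}"] by simp

lemma action_one: "\<rho> (mat 1) w = w"
  using rep by (simp add: rational_representation_def)

lemma action_mult: "g \<in> G \<Longrightarrow> h \<in> G \<Longrightarrow> \<rho> (g ** h) w = \<rho> g (\<rho> h w)"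
  using rep by (simp add: rational_representation_def)

lemma subgroup_torus: "subgroup R GL"
  using torus unfolding torus_def linear_algebraic_group_def by (elim conjE)

lemma weights_independent:
  assumes "finite C" "C \<subseteq> carrier (character_group R)"
    and "\<And>t. t \<in> R \<Longrightarrow> (\<Sum>\<theta>\<in>C. scl (\<theta> t) (w \<theta>)) = 0" and "\<theta> \<in> C"
  shows "w \<theta> = 0"
proof (rule characters_independent[where scl = scl and R = R and m = "(**)" and C = C])
  show "R \<noteq> {}" using subgroup_GL_one[OF subgroup_torus] by blast
  show "s ** t \<in> R" if "s \<in> R" "t \<in> R" for s t
    using that by (rule subgroup_GL_mult[OF subgroup_torus])
  fix \<theta> s t assume "\<theta> \<in> C"
  then have \<theta>: "\<theta> \<in> carrier (character_group R)" using assms(2) by blast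
  then show "\<theta> \<in> extensional R" by (simp add: carrier_character_group)
  show "\<theta> t \<noteq> 0" if "t \<in> R" using \<theta> that by (simp add: carrier_character_group)
  show "\<theta> (s ** t) = \<theta> s * \<theta> t" if "s \<in> R" "t \<in> R"
    using \<theta> that by (simp add: carrier_character_group)
qed (use assms V.vector_space_axioms in auto)

lemma orbit_map_regular:
  "\<exists>B F. finite B \<and> (\<forall>b\<in>B. F b \<in> GL_coordinate_ring) \<and>
     (\<forall>g\<in>G. \<rho> g u = (\<Sum>b\<in>B. scl (F b g) b))"
proof -
  have "\<exists>B. finite B \<and> \<not> V.dependent B \<and> u \<in> V.span B \<and>
      (\<forall>b\<in>B. (\<forall>g\<in>G. \<rho> g b \<in> V.span B) \<and>
        (\<forall>b'\<in>B. (\<lambda>g. V.representation B (\<rho> g b) b') \<in> regular_functions G))"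
    using rep unfolding rational_representation_def by (elim conjE) (erule spec)
  then obtain B where B: "finite B" "\<not> V.dependent B" "u \<in> V.span B"
    "\<And>b g. b \<in> B \<Longrightarrow> g \<in> G \<Longrightarrow> \<rho> g b \<in> V.span B"
    "\<And>b b'. b \<in> B \<Longrightarrow> b' \<in> B \<Longrightarrow> (\<lambda>g. V.representation B (\<rho> g b) b') \<in> regular_functions G"
    by blast
  have "\<forall>b\<in>B. \<forall>b'\<in>B. \<exists>f\<in>GL_coordinate_ring. \<forall>g\<in>G. V.representation B (\<rho> g b) b' = f g"
    using B(5) unfolding restrictions_def by simp
  then obtain f where f: "\<And>b b'. b \<in> B \<Longrightarrow> b' \<in> B \<Longrightarrow> f b b' \<in> GL_coordinate_ring"
    "\<And>b b' g. b \<in> B \<Longrightarrow> b' \<in> B \<Longrightarrow> g \<in> G \<Longrightarrow> V.representation B (\<rho> g b) b' = f b b' g"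
    by metis
  let ?r = "V.representation B u"
  let ?F = "\<lambda>b' g. \<Sum>b\<in>B. ?r b * f b b' g"
  have "?F b' \<in> GL_coordinate_ring" if "b' \<in> B" for b'
    using f(1)[OF _ that] unfolding GL_coordinate_ring_def
    by (rule subalgebra_generated_linear_combination)
  moreover have "\<rho> g u = (\<Sum>b'\<in>B. scl (?F b' g) b')" if g: "g \<in> G" for g
  proof -
    have "\<rho> g u = \<rho> g (\<Sum>b\<in>B. scl (?r b) b)"
      by (simp add: V.sum_representation_eq[OF B(2,3,1)])
    also have "\<dots> = (\<Sum>b\<in>B. scl (?r b) (\<rho> g b))"
      using g by (simp add: action_sum action_scale)
    also have "\<dots> = (\<Sum>b\<in>B. scl (?r b) (\<Sum>b'\<in>B. scl (V.representation B (\<rho> g b) b') b'))"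
      using g B by (intro sum.cong refl) (simp add: V.sum_representation_eq)
    also have "\<dots> = (\<Sum>b\<in>B. \<Sum>b'\<in>B. scl (?r b * f b b' g) b')"
      using g by (intro sum.cong refl) (simp add: V.scale_sum_right f(2))
    also have "\<dots> = (\<Sum>b'\<in>B. \<Sum>b\<in>B. scl (?r b * f b b' g) b')" by (rule sum.swap)
    also have "\<dots> = (\<Sum>b'\<in>B. scl (?F b' g) b')" by (simp add: V.scale_sum_left)
    finally show ?thesis .
  qed
  ultimately show ?thesis using B(1) by (intro exI[of _ B] exI[of _ ?F]) blast
qed

lemma weight_decomposition_sum:
  assumes c: "is_weight_decomposition scl \<rho> R u c" and C: "finite C" "{\<theta>. c \<theta> \<noteq> 0} \<subseteq> C"
  shows "u = (\<Sum>\<theta>\<in>C. c \<theta>)"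
proof -
  have "u = (\<Sum>\<theta> | c \<theta> \<noteq> 0. c \<theta>)" using c by (simp add: is_weight_decomposition_def)
  also have "\<dots> = (\<Sum>\<theta>\<in>C. c \<theta>)" using C by (intro sum.mono_neutral_left) auto
  finally show ?thesis .
qed

text \<open>
  Both decompositions express \<open>\<rho> t u\<close> as a combination of characters of \<open>t\<close>, and the coefficients of
  such an expression are unique.
\<close>

lemma weight_decomposition_unique:
  assumes c: "is_weight_decomposition scl \<rho> R u c" and c': "is_weight_decomposition scl \<rho> R u c'"
  shows "c = c'"
proof
  fix \<theta>
  let ?C = "{\<theta>. c \<theta> \<noteq> 0} \<union> {\<theta>. c' \<theta> \<noteq> 0}"
  have fin: "finite ?C" using c c' by (simp add: is_weight_decomposition_def)
  have sub: "?C \<subseteq> carrier (character_group R)"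
    using c c' unfolding is_weight_decomposition_def by blast
  have action: "\<rho> t u = (\<Sum>\<theta>\<in>?C. scl (\<theta> t) (d \<theta>))"
    if "t \<in> R" "is_weight_decomposition scl \<rho> R u d" "{\<theta>. d \<theta> \<noteq> 0} \<subseteq> ?C" for t d
  proof -
    have "\<rho> t u = (\<Sum>\<theta>\<in>?C. \<rho> t (d \<theta>))"
      using weight_decomposition_sum[OF that(2) fin that(3)] action_sum[of t d ?C] that(1) RG by auto
    also have "\<dots> = (\<Sum>\<theta>\<in>?C. scl (\<theta> t) (d \<theta>))"
    proof (rule sum.cong[OF refl])
      fix \<theta> assume "\<theta> \<in> ?C"
      then have "d \<theta> \<in> weight_space scl \<rho> R \<theta>"
        using that(2) sub unfolding is_weight_decomposition_def by blast
      then show "\<rho> t (d \<theta>) = scl (\<theta> t) (d \<theta>)" using that(1) by (simp add: weight_space_def)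
    qed
    finally show ?thesis .
  qed
  have zero: "(\<Sum>\<theta>\<in>?C. scl (\<theta> t) (c \<theta> - c' \<theta>)) = 0" if "t \<in> R" for t
    using action[OF that c] action[OF that c'] by (simp add: V.scale_right_diff_distrib sum_subtractf)
  show "c \<theta> = c' \<theta>"
  proof (cases "\<theta> \<in> ?C")
    case True
    have "(\<lambda>\<theta>. c \<theta> - c' \<theta>) \<theta> = 0" by (rule weights_independent[OF fin sub zero True])
    then show ?thesis by simp
  qed auto
qed

lemma weight_decomposition_eq:
  assumes "is_weight_decomposition scl \<rho> R u c"
  shows "weight_decomposition scl \<rho> R u = c"
  unfolding weight_decomposition_def is_weight_decomposition_def[symmetric]
proof (rule the_equality)
  show "is_weight_decomposition scl \<rho> R u c" by (rule assms)
  show "c' = c" if "is_weight_decomposition scl \<rho> R u c'" for c'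
    using that assms by (rule weight_decomposition_unique)
qed

text \<open>
  Expanding the orbit map in characters gives \<open>\<rho> t u = (\<Sum>\<theta>\<in>C. \<theta> t \<cdot> w \<theta>)\<close>. Computing
  \<open>\<rho> (s ** t) u\<close> in two ways and comparing the coefficients of \<open>\<theta> t\<close> yields
  \<open>\<rho> s (w \<theta>) = \<theta> s \<cdot> w \<theta>\<close>; at \<open>t = mat 1\<close> the expansion sums to \<open>u\<close>.
\<close>

lemma weight_decomposition_exists: "\<exists>c. is_weight_decomposition scl \<rho> R u c"
proof -
  obtain B F where BF: "finite B" "\<forall>b\<in>B. F b \<in> GL_coordinate_ring"
    "\<forall>g\<in>G. \<rho> g u = (\<Sum>b\<in>B. scl (F b g) b)"
    using orbit_map_regular[of u] by (elim exE conjE) (rule that)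
  have "character_combination scl R (\<lambda>t. \<Sum>b\<in>B. scl (F b t) b)"
    using BF(2)
    by (intro character_combination_sum character_combination_scale V.vector_space_axioms)
      (simp add: regular_function_character_combination[OF torus])
  then obtain C w where C: "finite C" "C \<subseteq> carrier (character_group R)"
    and w: "\<forall>t\<in>R. (\<Sum>b\<in>B. scl (F b t) b) = (\<Sum>\<theta>\<in>C. scl (\<theta> t) (w \<theta>))"
    unfolding character_combination_def by blast
  have expand: "\<rho> t u = (\<Sum>\<theta>\<in>C. scl (\<theta> t) (w \<theta>))" if "t \<in> R" for t
    using bspec[OF w that] BF(3) that RG by auto
  have weight: "w \<theta> \<in> weight_space scl \<rho> R \<theta>" if \<theta>: "\<theta> \<in> C" for \<theta>
    unfolding weight_space_def
  proof (intro CollectI ballI)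
    fix s assume s: "s \<in> R"
    then have sG: "s \<in> G" using RG by blast
    have "(\<Sum>\<theta>\<in>C. scl (\<theta> t) (\<rho> s (w \<theta>) - scl (\<theta> s) (w \<theta>))) = 0" if t: "t \<in> R" for t
    proof -
      have "(\<Sum>\<theta>\<in>C. scl (\<theta> t) (scl (\<theta> s) (w \<theta>))) = (\<Sum>\<theta>\<in>C. scl (\<theta> (s ** t)) (w \<theta>))"
      proof (rule sum.cong[OF refl])
        fix \<theta> assume "\<theta> \<in> C"
        then have "\<theta> (s ** t) = \<theta> s * \<theta> t"
          using C(2) s t by (auto simp: carrier_character_group)
        then show "scl (\<theta> t) (scl (\<theta> s) (w \<theta>)) = scl (\<theta> (s ** t)) (w \<theta>)"
          by (simp add: mult.commute)
      qed
      also have "\<dots> = \<rho> (s ** t) u"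
        using expand[OF subgroup_GL_mult[OF subgroup_torus s t]] by simp
      also have "\<dots> = \<rho> s (\<Sum>\<theta>\<in>C. scl (\<theta> t) (w \<theta>))"
        using t RG sG expand[OF t] by (subst action_mult) auto
      also have "\<dots> = (\<Sum>\<theta>\<in>C. scl (\<theta> t) (\<rho> s (w \<theta>)))"
        by (simp add: action_sum[OF sG] action_scale[OF sG])
      finally show ?thesis by (simp add: V.scale_right_diff_distrib sum_subtractf)
    qed
    from weights_independent[OF C this \<theta>]
    show "\<rho> s (w \<theta>) = scl (\<theta> s) (w \<theta>)" by simp
  qed
  let ?c = "\<lambda>\<theta>. if \<theta> \<in> C then w \<theta> else 0"
  have one: "mat 1 \<in> R" by (rule subgroup_GL_one[OF subgroup_torus])
  have "u = (\<Sum>\<theta>\<in>C. scl (\<theta> (mat 1)) (w \<theta>))"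
    using expand[OF one] by (simp add: action_one)
  also have "\<dots> = (\<Sum>\<theta>\<in>C. w \<theta>)"
  proof (rule sum.cong[OF refl])
    fix \<theta> assume "\<theta> \<in> C"
    then have "\<theta> (mat 1 ** mat 1) = \<theta> (mat 1) * \<theta> (mat 1)" "\<theta> (mat 1) \<noteq> 0"
      using C(2) one unfolding carrier_character_group[abs_def] subset_iff
      by (auto simp: carrier_character_group simp del: matrix_mul_lid matrix_mul_rid)
    then show "scl (\<theta> (mat 1)) (w \<theta>) = w \<theta>" by simp
  qed
  also have "\<dots> = (\<Sum>\<theta> | ?c \<theta> \<noteq> 0. ?c \<theta>)"
    using C(1) by (intro sum.mono_neutral_cong_right) auto
  finally have "is_weight_decomposition scl \<rho> R u ?c"
    unfolding is_weight_decomposition_def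
    using C weight by (auto simp: weight_space_def action_zero[OF subsetD[OF RG]]
        intro: finite_subset[OF _ C(1)])
  then show ?thesis by blast
qed

lemma weight_decomposition_linear_combination:
  assumes "finite B" and w: "\<And>b. b \<in> B \<Longrightarrow> is_weight_decomposition scl \<rho> R b (w b)"
  shows "is_weight_decomposition scl \<rho> R (\<Sum>b\<in>B. scl (a b) b) (\<lambda>\<theta>. \<Sum>b\<in>B. scl (a b) (w b \<theta>))"
    (is "is_weight_decomposition _ _ _ _ ?c")
proof -
  let ?C = "\<Union>b\<in>B. {\<theta>. w b \<theta> \<noteq> 0}"
  have fin: "finite ?C" using assms by (simp add: is_weight_decomposition_def)
  have supp: "{\<theta>. ?c \<theta> \<noteq> 0} \<subseteq> ?C"
  proof
    fix \<theta> assume "\<theta> \<in> {\<theta>. ?c \<theta> \<noteq> 0}"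
    then obtain b where "b \<in> B" "scl (a b) (w b \<theta>) \<noteq> 0"
      by (metis (mono_tags, lifting) mem_Collect_eq sum.neutral)
    then show "\<theta> \<in> ?C" by auto
  qed
  have "(\<Sum>b\<in>B. scl (a b) b) = (\<Sum>b\<in>B. scl (a b) (\<Sum>\<theta>\<in>?C. w b \<theta>))"
  proof (rule sum.cong[OF refl])
    fix b assume b: "b \<in> B"
    have "b = (\<Sum>\<theta>\<in>?C. w b \<theta>)"
      by (rule weight_decomposition_sum[OF w[OF b] fin]) (use b in blast)
    then show "scl (a b) b = scl (a b) (\<Sum>\<theta>\<in>?C. w b \<theta>)" by (rule arg_cong)
  qed
  also have "\<dots> = (\<Sum>\<theta>\<in>?C. ?c \<theta>)"
    by (simp only: V.scale_sum_right) (rule sum.swap)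
  also have "\<dots> = (\<Sum>\<theta> | ?c \<theta> \<noteq> 0. ?c \<theta>)"
    using fin supp by (intro sum.mono_neutral_right) auto
  finally have sum: "(\<Sum>b\<in>B. scl (a b) b) = (\<Sum>\<theta> | ?c \<theta> \<noteq> 0. ?c \<theta>)" .
  have weight: "?c \<theta> \<in> weight_space scl \<rho> R \<theta>" if \<theta>: "\<theta> \<in> carrier (character_group R)" for \<theta>
    unfolding weight_space_def
  proof (intro CollectI ballI)
    fix t assume t: "t \<in> R"
    then have tG: "t \<in> G" using RG by blast
    have "\<rho> t (?c \<theta>) = (\<Sum>b\<in>B. scl (a b) (\<rho> t (w b \<theta>)))"
      by (simp add: action_sum[OF tG] action_scale[OF tG])
    also have "\<dots> = (\<Sum>b\<in>B. scl (\<theta> t) (scl (a b) (w b \<theta>)))"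
    proof (rule sum.cong[OF refl])
      fix b assume "b \<in> B"
      then have "\<rho> t (w b \<theta>) = scl (\<theta> t) (w b \<theta>)"
        using w[of b] \<theta> t by (simp add: is_weight_decomposition_def weight_space_def)
      then show "scl (a b) (\<rho> t (w b \<theta>)) = scl (\<theta> t) (scl (a b) (w b \<theta>))"
        by (simp add: mult.commute)
    qed
    also have "\<dots> = scl (\<theta> t) (?c \<theta>)" by (rule V.scale_sum_right[symmetric])
    finally show "\<rho> t (?c \<theta>) = scl (\<theta> t) (?c \<theta>)" .
  qed
  have outside: "?c \<theta> = 0" if "\<theta> \<notin> carrier (character_group R)" for \<theta>
  proof (rule sum.neutral, rule ballI)
    fix b assume "b \<in> B"
    then have "w b \<theta> = 0" using w[of b] that by (simp add: is_weight_decomposition_def)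
    then show "scl (a b) (w b \<theta>) = 0" by simp
  qed
  show ?thesis
    unfolding is_weight_decomposition_def
    using finite_subset[OF supp fin] weight outside sum by blast
qed

lemma state_orbit:
  "\<exists>(B :: 'v set) F w. finite B \<and> (\<forall>b\<in>B. F b \<in> GL_coordinate_ring) \<and>
     finite {\<theta>. \<exists>b\<in>B. w b \<theta> \<noteq> 0} \<and>
     (\<forall>g\<in>G. state scl \<rho> R (\<rho> g u) =
        {\<theta> \<in> carrier (character_group R). (\<Sum>b\<in>B. scl (F b g) (w b \<theta>)) \<noteq> 0})"
proof -
  obtain B F where BF: "finite B" "\<forall>b\<in>B. F b \<in> GL_coordinate_ring"
    "\<forall>g\<in>G. \<rho> g u = (\<Sum>b\<in>B. scl (F b g) b)"
    using orbit_map_regular[of u] by (elim exE conjE) (rule that)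
  obtain w where w: "\<And>b. is_weight_decomposition scl \<rho> R b (w b)"
    using weight_decomposition_exists by metis
  have "{\<theta>. \<exists>b\<in>B. w b \<theta> \<noteq> 0} = (\<Union>b\<in>B. {\<theta>. w b \<theta> \<noteq> 0})" by blast
  moreover have "finite {\<theta>. w b \<theta> \<noteq> 0}" for b using w by (simp add: is_weight_decomposition_def)
  ultimately have "finite {\<theta>. \<exists>b\<in>B. w b \<theta> \<noteq> 0}" using BF(1) by simp
  moreover have "state scl \<rho> R (\<rho> g u) =
      {\<theta> \<in> carrier (character_group R). (\<Sum>b\<in>B. scl (F b g) (w b \<theta>)) \<noteq> 0}" if "g \<in> G" for g
    using weight_decomposition_eq[OF weight_decomposition_linear_combination[OF BF(1) w]]
      BF(3) that by (simp add: state_def)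
  ultimately show ?thesis
    using BF(1,2) by (intro exI[of _ B] exI[of _ F] exI[of _ w] conjI) simp_all
qed

end


section \<open>Generic constancy of the state polytope\<close>

theorem mainTheorem3:
  fixes G R :: "('k::{alg_closed_field, field_char_0} ^'n^'n) set"
    and scl :: "'k \<Rightarrow> 'v::ab_group_add \<Rightarrow> 'v"
    and \<rho> :: "'k^'n^'n \<Rightarrow> 'v \<Rightarrow> 'v"
    and v :: 'v
  assumes "linear_algebraic_group G"
    and "connected_space (zariski G)"
    and "rational_representation scl G \<rho>"
    and "torus R" and "R \<subseteq> G"
  shows "\<exists>U. openin (zariski G) U \<and> U \<noteq> {} \<and>
    (\<forall>g\<in>U. \<forall>g'\<in>U. state_polytope scl \<rho> R (\<rho> g v) = state_polytope scl \<rho> R (\<rho> g' v))"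
proof -
  have sub: "subgroup G GL" using assms(1) by (simp add: linear_algebraic_group_def)
  then have GL: "G \<subseteq> carrier GL" by (rule subgroup.subset)
  interpret V: vector_space scl using assms(3) by (simp add: rational_representation_def)
  obtain B :: "'v set" and F w where B: "finite B" "\<forall>b\<in>B. F b \<in> GL_coordinate_ring"
    and fin: "finite {\<theta>. \<exists>b\<in>B. w b \<theta> \<noteq> 0}"
    and state: "\<forall>g\<in>G. state scl \<rho> R (\<rho> g v) =
        {\<theta> \<in> carrier (character_group R). (\<Sum>b\<in>B. scl (F b g) (w b \<theta>)) \<noteq> 0}"
    using state_orbit[OF assms(3) sub assms(4,5), of v] by (elim exE conjE) (rule that)
  define D where "D \<theta> = {g \<in> G. (\<Sum>b\<in>B. scl (F b g) (w b \<theta>)) \<noteq> 0}" for \<theta>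
  have D_open: "openin (zariski G) (D \<theta>)" for \<theta>
    unfolding D_def using B by (intro openin_zariski_nonvanishing V.vector_space_axioms GL) auto
  have "{\<theta>. D \<theta> \<noteq> {}} \<subseteq> {\<theta>. \<exists>b\<in>B. w b \<theta> \<noteq> 0}"
  proof
    fix \<theta> assume "\<theta> \<in> {\<theta>. D \<theta> \<noteq> {}}"
    then obtain g where "(\<Sum>b\<in>B. scl (F b g) (w b \<theta>)) \<noteq> 0" by (auto simp: D_def)
    then obtain b where "b \<in> B" "scl (F b g) (w b \<theta>) \<noteq> 0"
      by (metis (mono_tags, lifting) sum.neutral)
    then show "\<theta> \<in> {\<theta>. \<exists>b\<in>B. w b \<theta> \<noteq> 0}" by auto
  qed
  then have "finite {\<theta>. D \<theta> \<noteq> {}}" using fin by (rule finite_subset)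
  then have "finite (D ` {\<theta>. D \<theta> \<noteq> {}})" by simp
  define U where "U = topspace (zariski G) \<inter> \<Inter>(D ` {\<theta>. D \<theta> \<noteq> {}})"
  have U: "openin (zariski G) U \<and> U \<noteq> {}"
    unfolding U_def
    by (rule irreducible_open_finite_Inter
        [OF connected_linear_algebraic_group_irreducible[OF assms(1,2)]])
      (use D_open \<open>finite (D ` _)\<close> in auto)
  have "state scl \<rho> R (\<rho> g v) = {\<theta> \<in> carrier (character_group R). D \<theta> \<noteq> {}}" if g: "g \<in> U" for g
  proof -
    have gG: "g \<in> G" using g topspace_zariski[OF GL] by (auto simp: U_def)
    have "g \<in> D \<theta> \<longleftrightarrow> D \<theta> \<noteq> {}" for \<theta> using g by (auto simp: U_def)
    then show ?thesis using bspec[OF state gG] gG by (auto simp: D_def)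
  qed
  then have "state_polytope scl \<rho> R (\<rho> g v) = state_polytope scl \<rho> R (\<rho> g' v)"
    if "g \<in> U" "g' \<in> U" for g g' using that by (simp add: state_polytope_def)
  with U show ?thesis by blast
qed

end
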